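(* Let $(\Lambda(U,V),d)$ be a two-stage, elliptic minimal model over $\mathbb{Q}$ with odd degree generators only, and assume that the two-stage decomposition displays $V$ with maximal dimension. Suppose there are positive integers $r$ and $s$, with $r\le s\le 2r$, for which $U=U^{\mathrm{odd}}$ is $(r-1)$-connected and $(s+1)$-co-connected. Suppose further that there are positive integers $t$ and $u$, with $s\le t\le u\le s+r$, for which $V$ is $(t-1)$-connected and $(u+1)$-co-connected. Then $$\mathrm{rk}_0\big(\Lambda(U,V)\big)\ \leq\ \dim V.$$
   Context: All vector spaces and algebras are over $\mathbb{Q}$. For a graded vector space $W$ concentrated in degrees $\ge 2$ (all spaces are assumed 1-connected), $\Lambda W$ is the free graded commutative algebra on $W$. A minimal model is a differential graded algebra $(\Lambda W,d)$ with $d$ of degree $+1$ such that $dw$ is a polynomial with no linear term for each $w\in W$. It is elliptic if $W$ and $H(\Lambda W,d)$ are both finite-dimensional. It is two-stage if there is a graded decomposition $W=U\oplus V$ with $dU=0$ and $dV\subseteq\Lambda U$; one then writes $\Lambda(U,V)$, with this decomposition understood. The two-stage decomposition displays $V$ with maximal dimension if for every two-stage minimal model $(\Lambda(U',V'),d')$ isomorphic to $(\Lambda(U,V),d)$ one has $\dim V'\le\dim V$. A graded vector space $Z$ is $n$-connected if $Z^i=0$ for $i\le n$, and $n$-co-connected if $Z^i=0$ for $i\ge n$. Rational toral rank: $\mathrm{rk}_0(\Lambda W)$ is the largest $n\ge0$ for which there is an extension $\Lambda A_n\to(\Lambda A_n\otimes\Lambda W,D)\to(\Lambda W,d)$ with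 $A_n=\langle a_1,\dots,a_n\rangle$, each $a_i$ of degree $2$, such that $H(\Lambda A_n\otimes\Lambda W,D)$ is finite-dimensional. Here an extension (K-S extension) means that $D$ is a differential with $D a_i=0$, that $D$ induces $d$ on the quotient $\Lambda W=(\Lambda A_n\otimes\Lambda W)/(A_n)$, and that $W$ has an ordered basis $w_1,w_2,\dots$ with $Dw_i\in\Lambda A_n\otimes\Lambda(w_1,\dots,w_{i-1})$ for each $i$. *)

theory Defs
  imports Complex_Main "HOL-Library.Multiset" "HOL-Library.Poly_Mapping"
    "HOL-Library.Extended_Nat"
begin

section \<open>The universal free graded commutative algebra over the rationals\<close>

text \<open>
  A graded vector space is given by a homogeneous basis: a set of generators, each carrying its
  degree.  There are countably many generators in every degree, so every graded space of countable
  dimension, in particular every finite-dimensional one, arises from a set of generators.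
  All free algebras considered live inside the single type \<open>gca\<close>, which is free on all generators.
\<close>

datatype gen = Gen (gdeg: nat) (gidx: nat)

text \<open>An auxiliary total order on generators, used only to fix the order of odd factors.\<close>

definition gen_less :: "gen \<Rightarrow> gen \<Rightarrow> bool" where
  "gen_less x y \<longleftrightarrow> gdeg x < gdeg y \<or> gdeg x = gdeg y \<and> gidx x < gidx y"

lemma gen_less_total: "x \<noteq> y \<Longrightarrow> gen_less x y \<longleftrightarrow> \<not> gen_less y x"
  by (cases x; cases y) (auto simp: gen_less_def not_less le_less)

text \<open>
  A monomial is a multiset of generators in which no odd generator is repeated; it stands for the
  product of its elements in increasing order.
\<close>

definition admissible :: "gen multiset \<Rightarrow> bool" where
  "admissible m \<longleftrightarrow> (\<forall>x. odd (gdeg x) \<longrightarrow> count m x \<le> 1)"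

definition mdeg :: "gen multiset \<Rightarrow> nat" where
  "mdeg m = (\<Sum>x\<in>#m. gdeg x)"

text \<open>
  Sorting the concatenation of two sorted monomials interchanges one pair of odd factors for each
  inversion counted here; this gives the Koszul sign of the product.
\<close>

definition inversions :: "gen multiset \<Rightarrow> gen multiset \<Rightarrow> nat" where
  "inversions m n =
     (\<Sum>x\<in>#m. \<Sum>y\<in>#n. if odd (gdeg x) \<and> odd (gdeg y) \<and> gen_less y x then 1 else 0)"

definition koszul :: "gen multiset \<Rightarrow> gen multiset \<Rightarrow> rat" where
  "koszul m n = (if admissible (m + n) then (-1) ^ inversions m n else 0)"

definition tmul :: "(gen multiset \<Rightarrow>\<^sub>0 rat) \<Rightarrow> (gen multiset \<Rightarrow>\<^sub>0 rat) \<Rightarrow> (gen multiset \<Rightarrow>\<^sub>0 rat)" where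
  "tmul p q = (\<Sum>m\<in>Poly_Mapping.keys p. \<Sum>n\<in>Poly_Mapping.keys q.
     Poly_Mapping.single (m + n)
       (koszul m n * Poly_Mapping.lookup p m * Poly_Mapping.lookup q n))"

lemma admissible_empty [simp]: "admissible {#}"
  by (simp add: admissible_def)

lemma admissible_single [simp]: "admissible {#x#}"
  by (simp add: admissible_def)

lemma admissible_add: "admissible (m + n) \<Longrightarrow> admissible m \<and> admissible n"
  unfolding admissible_def by fastforce

lemma inversions_add_left: "inversions (m + n) k = inversions m k + inversions n k"
  by (simp add: inversions_def)

lemma inversions_add_right: "inversions m (n + k) = inversions m n + inversions m k"
  by (simp add: inversions_def sum_mset.distrib)

lemma koszul_assoc: "koszul m n * koszul (m + n) k = koszul m (n + k) * koszul n k"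
  using admissible_add[of "m + n" k] admissible_add[of m "n + k"]
  by (auto simp: koszul_def inversions_add_left inversions_add_right power_add add.assoc)

lemma tmul_superset:
  assumes "finite K" "finite L" "Poly_Mapping.keys p \<subseteq> K" "Poly_Mapping.keys q \<subseteq> L"
  shows "tmul p q = (\<Sum>m\<in>K. \<Sum>n\<in>L. Poly_Mapping.single (m + n)
     (koszul m n * Poly_Mapping.lookup p m * Poly_Mapping.lookup q n))"
proof -
  have "tmul p q = (\<Sum>m\<in>Poly_Mapping.keys p. \<Sum>n\<in>L. Poly_Mapping.single (m + n)
     (koszul m n * Poly_Mapping.lookup p m * Poly_Mapping.lookup q n))"
    unfolding tmul_def
    by (intro sum.cong refl sum.mono_neutral_left) (use assms in \<open>auto simp: in_keys_iff\<close>)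
  also have "\<dots> = (\<Sum>m\<in>K. \<Sum>n\<in>L. Poly_Mapping.single (m + n)
     (koszul m n * Poly_Mapping.lookup p m * Poly_Mapping.lookup q n))"
    by (intro sum.mono_neutral_left) (use assms in \<open>auto simp: in_keys_iff\<close>)
  finally show ?thesis .
qed

lemma tmul_add_left: "tmul (p + p') q = tmul p q + tmul p' q"
  using Poly_Mapping.keys_add[of p p']
  by (simp add: tmul_superset[of "Poly_Mapping.keys p \<union> Poly_Mapping.keys p'" "Poly_Mapping.keys q"]
      lookup_add distrib_left distrib_right single_add sum.distrib)

lemma tmul_add_right: "tmul p (q + q') = tmul p q + tmul p q'"
  using Poly_Mapping.keys_add[of q q']
  by (simp add: tmul_superset[of "Poly_Mapping.keys p" "Poly_Mapping.keys q \<union> Poly_Mapping.keys q'"]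
      lookup_add distrib_left distrib_right single_add sum.distrib)

lemma tmul_zero_left [simp]: "tmul 0 q = 0"
  by (simp add: tmul_def)

lemma tmul_zero_right [simp]: "tmul p 0 = 0"
  by (simp add: tmul_def)

lemma tmul_single:
  "tmul (Poly_Mapping.single m a) (Poly_Mapping.single n b)
   = Poly_Mapping.single (m + n) (koszul m n * a * b)"
  by (simp add: tmul_superset[of "{m}" "{n}"])

lemma poly_mapping_add_induct [case_names zero single_plus]:
  fixes p :: "'a \<Rightarrow>\<^sub>0 'b::comm_monoid_add"
  assumes "P 0"
    and "\<And>m a p. P p \<Longrightarrow> m \<notin> Poly_Mapping.keys p \<Longrightarrow> a \<noteq> 0 \<Longrightarrow> P (Poly_Mapping.single m a + p)"
  shows "P p"
proof (induction p rule: Poly_Mapping.update_induct)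
  case const
  then show ?case by (rule assms(1))
next
  case (update p m a)
  have "Poly_Mapping.update m a p = Poly_Mapping.single m a + p"
    using update(1)
    by (intro poly_mapping_eqI) (auto simp: lookup_update lookup_add lookup_single in_keys_iff when_def)
  then show ?case using update assms(2) by simp
qed

lemma tmul_assoc: "tmul (tmul p q) s = tmul p (tmul q s)"
proof (induction p rule: poly_mapping_add_induct)
  case (single_plus m a p)
  have "tmul (tmul (Poly_Mapping.single m a) q) s = tmul (Poly_Mapping.single m a) (tmul q s)"
  proof (induction q rule: poly_mapping_add_induct)
    case (single_plus n b q)
    have "tmul (tmul (Poly_Mapping.single m a) (Poly_Mapping.single n b)) s
      = tmul (Poly_Mapping.single m a) (tmul (Poly_Mapping.single n b) s)"
    proof (induction s rule: poly_mapping_add_induct)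
      case (single_plus k c s)
      have eq: "koszul (m + n) k * (koszul m n * a * b) * c = koszul m (n + k) * a * (koszul n k * b * c)"
        using arg_cong[OF koszul_assoc[of m n k], of "\<lambda>z. z * (a * b * c)"] by (simp add: ac_simps)
      then show ?case
        using single_plus.IH by (simp only: tmul_add_right tmul_single add.assoc eq)
    qed simp
    then show ?case using single_plus by (simp add: tmul_add_right tmul_add_left)
  qed simp
  then show ?case using single_plus by (simp add: tmul_add_left)
qed simp

typedef gca = "{p :: gen multiset \<Rightarrow>\<^sub>0 rat. \<forall>m\<in>Poly_Mapping.keys p. admissible m}"
  morphisms rep_gca Abs_gca
  by (rule exI[of _ 0]) simp

setup_lifting type_definition_gca

lift_definition coeff :: "gca \<Rightarrow> gen multiset \<Rightarrow> rat" is Poly_Mapping.lookup .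

lift_definition gen :: "gen \<Rightarrow> gca" is "\<lambda>x. Poly_Mapping.single {#x#} 1"
  by simp

lift_definition qscale :: "rat \<Rightarrow> gca \<Rightarrow> gca" is "\<lambda>c. Poly_Mapping.map ((*) c)"
  by (auto simp: in_keys_iff map.rep_eq when_def split: if_splits)

lemma lookup_map_times:
  "Poly_Mapping.lookup (Poly_Mapping.map ((*) (c::rat)) p) k = c * Poly_Mapping.lookup p k"
  by (simp add: map.rep_eq when_def)

lemma map_times_single:
  "Poly_Mapping.map ((*) (c::rat)) (Poly_Mapping.single m a) = Poly_Mapping.single m (c * a)"
  by (intro poly_mapping_eqI) (simp add: lookup_map_times lookup_single when_def)

lemma map_times_add:
  "Poly_Mapping.map ((*) (c::rat)) (p + q) = Poly_Mapping.map ((*) c) p + Poly_Mapping.map ((*) c) q"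
  by (intro poly_mapping_eqI) (simp add: lookup_map_times lookup_add distrib_left)

lemma map_times_zero: "Poly_Mapping.map ((*) (c::rat)) 0 = 0"
  by (intro poly_mapping_eqI) (simp add: lookup_map_times)

lemma tmul_map_left:
  "tmul (Poly_Mapping.map ((*) a) p) q = Poly_Mapping.map ((*) a) (tmul p q)"
proof (induction p rule: poly_mapping_add_induct)
  case (single_plus m c p)
  have "tmul (Poly_Mapping.map ((*) a) (Poly_Mapping.single m c)) q
    = Poly_Mapping.map ((*) a) (tmul (Poly_Mapping.single m c) q)"
    by (induction q rule: poly_mapping_add_induct)
      (simp_all add: map_times_zero map_times_add map_times_single tmul_add_right tmul_single
        mult.assoc mult.left_commute)
  then show ?case using single_plus.IH by (simp add: map_times_add tmul_add_left)
qed (simp add: map_times_zero)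

lemma tmul_map_right:
  "tmul p (Poly_Mapping.map ((*) a) q) = Poly_Mapping.map ((*) a) (tmul p q)"
proof (induction p rule: poly_mapping_add_induct)
  case (single_plus m c p)
  have "tmul (Poly_Mapping.single m c) (Poly_Mapping.map ((*) a) q)
    = Poly_Mapping.map ((*) a) (tmul (Poly_Mapping.single m c) q)"
    by (induction q rule: poly_mapping_add_induct)
      (simp_all add: map_times_zero map_times_add map_times_single tmul_add_right tmul_single
        mult.assoc mult.left_commute)
  then show ?case using single_plus.IH by (simp add: map_times_add tmul_add_left)
qed (simp add: map_times_zero)

lemma koszul_nonzero: "koszul m n \<noteq> 0 \<Longrightarrow> admissible (m + n)"
  by (auto simp: koszul_def split: if_splits)

lemma keys_tmul_admissible: "m \<in> Poly_Mapping.keys (tmul p q) \<Longrightarrow> admissible m"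
  unfolding tmul_def
  by (auto dest!: subsetD[OF keys_sum] split: if_splits simp: koszul_nonzero)

lemma sum_single_lookup:
  "(\<Sum>n\<in>Poly_Mapping.keys p. Poly_Mapping.single n (Poly_Mapping.lookup p n)) = p"
  by (intro poly_mapping_eqI) (simp add: lookup_sum lookup_single when_def in_keys_iff)

lemma tmul_one_left:
  assumes "\<forall>m\<in>Poly_Mapping.keys p. admissible m"
  shows "tmul (Poly_Mapping.single {#} 1) p = p"
proof -
  have "tmul (Poly_Mapping.single {#} 1) p
    = (\<Sum>n\<in>Poly_Mapping.keys p. Poly_Mapping.single n (Poly_Mapping.lookup p n))"
    using assms
    by (simp add: tmul_superset[of "{{#}}" "Poly_Mapping.keys p"] koszul_def inversions_def)
  then show ?thesis by (simp add: sum_single_lookup)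
qed

lemma tmul_one_right:
  assumes "\<forall>m\<in>Poly_Mapping.keys p. admissible m"
  shows "tmul p (Poly_Mapping.single {#} 1) = p"
proof -
  have "tmul p (Poly_Mapping.single {#} 1)
    = (\<Sum>n\<in>Poly_Mapping.keys p. Poly_Mapping.single n (Poly_Mapping.lookup p n))"
    using assms
    by (simp add: tmul_superset[of "Poly_Mapping.keys p" "{{#}}"] koszul_def inversions_def)
  then show ?thesis by (simp add: sum_single_lookup)
qed

instantiation gca :: ring_1
begin

lift_definition zero_gca :: gca is 0 by simp

lift_definition one_gca :: gca is "Poly_Mapping.single {#} 1" by simp

lift_definition plus_gca :: "gca \<Rightarrow> gca \<Rightarrow> gca" is "(+)"
  by (meson Poly_Mapping.keys_add Un_iff subsetD)

lift_definition uminus_gca :: "gca \<Rightarrow> gca" is uminus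
  by simp

lift_definition minus_gca :: "gca \<Rightarrow> gca \<Rightarrow> gca" is "(-)"
  by (meson keys_diff Un_iff subsetD)

lift_definition times_gca :: "gca \<Rightarrow> gca \<Rightarrow> gca" is tmul
  by (auto dest: keys_tmul_admissible)

instance
proof
  show "(0::gca) \<noteq> 1"
  proof transfer
    have "Poly_Mapping.lookup (Poly_Mapping.single ({#} :: gen multiset) (1::rat)) {#} \<noteq> 0"
      by simp
    then show "(0 :: gen multiset \<Rightarrow>\<^sub>0 rat) \<noteq> Poly_Mapping.single {#} 1"
      by (auto dest!: sym)
  qed
  show "a * b * c = a * (b * c)" for a b c :: gca
    by transfer (rule tmul_assoc)
  show "1 * a = a" for a :: gca
    by transfer (rule tmul_one_left)
  show "a * 1 = a" for a :: gca
    by transfer (rule tmul_one_right)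
  show "(a + b) * c = a * c + b * c" for a b c :: gca
    by transfer (rule tmul_add_left)
  show "a * (b + c) = a * b + a * c" for a b c :: gca
    by transfer (rule tmul_add_right)
  show "a + b + c = a + (b + c)" for a b c :: gca
    by transfer (rule add.assoc)
  show "a + b = b + a" for a b :: gca
    by transfer (rule add.commute)
  show "0 + a = a" for a :: gca
    by transfer (rule add_0_left)
  show "- a + a = 0" for a :: gca
    by transfer (rule left_minus)
  show "a - b = a + - b" for a b :: gca
    by transfer (rule diff_conv_add_uminus)
qed

end

global_interpretation Q: vector_space qscale
proof
  fix a b :: rat and x y :: gca
  show "qscale a (x + y) = qscale a x + qscale a y"
    by transfer (rule poly_mapping_eqI, simp add: lookup_map_times lookup_add distrib_left)
  show "qscale (a + b) x = qscale a x + qscale b x"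
    by transfer (rule poly_mapping_eqI, simp add: lookup_map_times lookup_add distrib_right)
  show "qscale a (qscale b x) = qscale (a * b) x"
    by transfer (rule poly_mapping_eqI, simp add: lookup_map_times)
  show "qscale 1 x = x"
    by transfer (rule poly_mapping_eqI, simp add: lookup_map_times)
qed

definition homogeneous :: "nat \<Rightarrow> gca set" where
  "homogeneous k = {p. \<forall>m. coeff p m \<noteq> 0 \<longrightarrow> mdeg m = k}"

inductive_set subalg :: "gca set \<Rightarrow> gca set" for S where
  one: "1 \<in> subalg S"
| base: "x \<in> S \<Longrightarrow> x \<in> subalg S"
| add: "x \<in> subalg S \<Longrightarrow> y \<in> subalg S \<Longrightarrow> x + y \<in> subalg S"
| scale: "x \<in> subalg S \<Longrightarrow> qscale c x \<in> subalg S"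
| mult: "x \<in> subalg S \<Longrightarrow> y \<in> subalg S \<Longrightarrow> x * y \<in> subalg S"

definition lin :: "gen set \<Rightarrow> gca set" where
  "lin X = Q.span (gen ` X)"

definition \<Lambda> :: "gen set \<Rightarrow> gca set" where
  "\<Lambda> X = subalg (gen ` X)"

definition ideal_in :: "gca set \<Rightarrow> gca set \<Rightarrow> gca set" where
  "ideal_in R S = Q.span {x * a * y | x a y. x \<in> R \<and> a \<in> S \<and> y \<in> R}"


section \<open>Graded commutativity and the monomial basis\<close>

lemma inversions_swap:
  assumes "admissible (m + n)"
  shows "even (inversions m n + inversions n m + mdeg m * mdeg n)"
proof -
  have *: "\<not> (odd (gdeg x) \<and> x \<in># n)" if "x \<in># m" for x
  proof
    assume "odd (gdeg x) \<and> x \<in># n"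
    then have "count m x + count n x \<le> 1" "count m x > 0" "count n x > 0"
      using assms that by (auto simp: admissible_def)
    then show False by linarith
  qed
  have swap: "inversions n m
     = (\<Sum>x\<in>#m. \<Sum>y\<in>#n. if odd (gdeg y) \<and> odd (gdeg x) \<and> gen_less x y then 1 else 0)"
    unfolding inversions_def by (rule sum_mset.swap)
  have prod: "mdeg m * mdeg n = (\<Sum>x\<in>#m. \<Sum>y\<in>#n. gdeg x * gdeg y)"
    by (simp add: mdeg_def sum_mset_distrib_left sum_mset_distrib_right) (rule sum_mset.swap)
  have even_sum: "even (sum_mset (image_mset f k))" if "\<And>x. x \<in># k \<Longrightarrow> even (f x)"
    for f :: "gen \<Rightarrow> nat" and k
    using that by (induction k) auto
  have "inversions m n + inversions n m + mdeg m * mdeg n = (\<Sum>x\<in>#m. \<Sum>y\<in>#n.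
      (if odd (gdeg x) \<and> odd (gdeg y) \<and> gen_less y x then 1 else 0)
    + (if odd (gdeg y) \<and> odd (gdeg x) \<and> gen_less x y then 1 else 0) + gdeg x * gdeg y)"
    unfolding swap prod sum_mset.distrib by (simp only: inversions_def)
  also have "even \<dots>"
  proof (intro even_sum)
    fix x y assume "x \<in># m" "y \<in># n"
    then have "gen_less x y \<longleftrightarrow> \<not> gen_less y x" if "odd (gdeg x)"
      using that * gen_less_total[of x y] by blast
    then show "even ((if odd (gdeg x) \<and> odd (gdeg y) \<and> gen_less y x then 1 else 0)
      + (if odd (gdeg y) \<and> odd (gdeg x) \<and> gen_less x y then 1 else 0) + gdeg x * gdeg y)"
      by auto
  qed
  finally show ?thesis .
qed

lemma koszul_swap: "koszul m n = (-1) ^ (mdeg m * mdeg n) * koszul n m"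
proof (cases "admissible (m + n)")
  case True
  have "even (inversions m n) \<longleftrightarrow> even (mdeg m * mdeg n + inversions n m)"
    using inversions_swap[OF True] by (auto simp: even_add)
  then have "(-1::rat) ^ inversions m n = (-1) ^ (mdeg m * mdeg n + inversions n m)"
    by (simp only: minus_one_power_iff)
  then show ?thesis using True by (simp add: koszul_def add.commute power_add)
qed (simp add: koszul_def add.commute)

lemma graded_commutative:
  assumes "x \<in> homogeneous j" "y \<in> homogeneous k"
  shows "x * y = qscale ((-1) ^ (j * k)) (y * x)"
  using assms unfolding homogeneous_def mem_Collect_eq
proof transfer
  fix j k :: nat and p q :: "gen multiset \<Rightarrow>\<^sub>0 rat"
  assume p: "\<forall>m. Poly_Mapping.lookup p m \<noteq> 0 \<longrightarrow> mdeg m = j"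
    and q: "\<forall>m. Poly_Mapping.lookup q m \<noteq> 0 \<longrightarrow> mdeg m = k"
  have map_sum: "Poly_Mapping.map ((*) c) (sum f K) = (\<Sum>i\<in>K. Poly_Mapping.map ((*) c) (f i))"
    for c :: rat and f :: "gen multiset \<Rightarrow> gen multiset \<Rightarrow>\<^sub>0 rat" and K
    by (intro poly_mapping_eqI) (simp add: lookup_map_times lookup_sum sum_distrib_left)
  have "tmul p q = (\<Sum>m\<in>Poly_Mapping.keys p. \<Sum>n\<in>Poly_Mapping.keys q.
      Poly_Mapping.map ((*) ((-1) ^ (j * k)))
        (Poly_Mapping.single (n + m)
          (koszul n m * Poly_Mapping.lookup q n * Poly_Mapping.lookup p m)))"
    unfolding tmul_def
  proof (intro sum.cong refl)
    fix m n assume "m \<in> Poly_Mapping.keys p" "n \<in> Poly_Mapping.keys q"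
    then have "mdeg m = j" "mdeg n = k" using p q by (auto simp: in_keys_iff)
    then show "Poly_Mapping.single (m + n)
        (koszul m n * Poly_Mapping.lookup p m * Poly_Mapping.lookup q n)
      = Poly_Mapping.map ((*) ((-1) ^ (j * k))) (Poly_Mapping.single (n + m)
        (koszul n m * Poly_Mapping.lookup q n * Poly_Mapping.lookup p m))"
      by (intro poly_mapping_eqI)
        (simp add: koszul_swap[of m n] lookup_map_times lookup_single when_def add.commute)
  qed
  also have "\<dots> = Poly_Mapping.map ((*) ((-1) ^ (j * k))) (tmul q p)"
    unfolding tmul_def map_sum by (rule sum.swap)
  finally show "tmul p q = Poly_Mapping.map ((*) ((-1) ^ (j * k))) (tmul q p)" .
qed


lift_definition monom :: "gen multiset \<Rightarrow> gca"
  is "\<lambda>m. if admissible m then Poly_Mapping.single m 1 else 0"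
  by (auto split: if_splits)

lemma gca_eqI: "(\<And>m. coeff p m = coeff q m) \<Longrightarrow> p = q"
  by transfer (rule poly_mapping_eqI)

lemma coeff_zero [simp]: "coeff 0 m = 0"
  by transfer simp

lemma coeff_add [simp]: "coeff (p + q) m = coeff p m + coeff q m"
  by transfer (rule lookup_add)

lemma coeff_qscale [simp]: "coeff (qscale c p) m = c * coeff p m"
  by transfer (rule lookup_map_times)

lemma coeff_sum: "coeff (sum f A) m = (\<Sum>i\<in>A. coeff (f i) m)"
  by (induction A rule: infinite_finite_induct) simp_all

lemma coeff_monom: "coeff (monom m) n = (if admissible m \<and> m = n then 1 else 0)"
  by transfer (auto simp: lookup_single when_def)

lemma coeff_admissible: "coeff p m \<noteq> 0 \<Longrightarrow> admissible m"
  by transfer (simp add: in_keys_iff)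

lemma finite_coeff: "finite {m. coeff p m \<noteq> 0}"
  by transfer (rule finite_lookup)

lemma sum_monom: "(\<Sum>m | coeff p m \<noteq> 0. qscale (coeff p m) (monom m)) = p"
proof (rule gca_eqI)
  fix n
  have "coeff (\<Sum>m | coeff p m \<noteq> 0. qscale (coeff p m) (monom m)) n
    = (\<Sum>m | coeff p m \<noteq> 0. if m = n then coeff p n else 0)"
    by (auto simp: coeff_sum coeff_monom coeff_admissible intro!: sum.cong)
  then show "coeff (\<Sum>m | coeff p m \<noteq> 0. qscale (coeff p m) (monom m)) n = coeff p n"
    using finite_coeff[of p] by simp
qed

lemma monom_empty: "monom {#} = 1"
  by transfer simp

lemma gen_eq_monom: "gen x = monom {#x#}"
  by transfer simp

lemma monom_mult: "monom m * monom n = qscale (koszul m n) (monom (m + n))"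
proof transfer
  fix m n
  show "tmul (if admissible m then Poly_Mapping.single m 1 else 0)
      (if admissible n then Poly_Mapping.single n 1 else 0)
    = Poly_Mapping.map ((*) (koszul m n)) (if admissible (m + n) then Poly_Mapping.single (m + n) 1 else 0)"
    using admissible_add[of m n]
    by (intro poly_mapping_eqI)
      (auto simp: tmul_single lookup_map_times lookup_single when_def koszul_def)
qed

text \<open>The algebra on \<open>X\<close> has the admissible monomials in \<open>X\<close> as a basis.\<close>

lemma mem_Lambda_iff: "p \<in> \<Lambda> X \<longleftrightarrow> (\<forall>m. coeff p m \<noteq> 0 \<longrightarrow> set_mset m \<subseteq> X)"
proof
  assume "p \<in> \<Lambda> X"
  then show "\<forall>m. coeff p m \<noteq> 0 \<longrightarrow> set_mset m \<subseteq> X"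
    unfolding \<Lambda>_def
  proof induction
    case (add p q)
    then show ?case by (metis add_0 coeff_add)
  next
    case (scale p c)
    then show ?case by (simp add: mult_eq_0_iff)
  next
    case (mult p q)
    have pq: "p * q = (\<Sum>m | coeff p m \<noteq> 0. qscale (coeff p m) (monom m))
       * (\<Sum>n | coeff q n \<noteq> 0. qscale (coeff q n) (monom n))"
      by (simp only: sum_monom)
    have scale_mult: "qscale a x * qscale b y = qscale (a * b) (x * y)" for a b x y
    proof -
      have "qscale a x * qscale b y = qscale b (qscale a (x * y))"
        by transfer (simp only: tmul_map_left tmul_map_right)
      then show ?thesis by (simp add: mult.commute)
    qed
    show ?case
    proof (intro allI impI)
      fix k assume "coeff (p * q) k \<noteq> 0"
      then have "(\<Sum>m | coeff p m \<noteq> 0. \<Sum>n | coeff q n \<noteq> 0.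
          coeff (qscale (coeff p m * coeff q n) (qscale (koszul m n) (monom (m + n)))) k) \<noteq> 0"
        by (simp only: pq sum_product coeff_sum scale_mult monom_mult simp_thms)
      then obtain m where m: "m \<in> {m. coeff p m \<noteq> 0}"
          "(\<Sum>n | coeff q n \<noteq> 0. coeff (qscale (coeff p m * coeff q n)
            (qscale (koszul m n) (monom (m + n)))) k) \<noteq> 0"
        by (rule sum.not_neutral_contains_not_neutral)
      from m(2) obtain n where n: "n \<in> {n. coeff q n \<noteq> 0}"
          "coeff (qscale (coeff p m * coeff q n) (qscale (koszul m n) (monom (m + n)))) k \<noteq> 0"
        by (rule sum.not_neutral_contains_not_neutral)
      then have "k = m + n" by (auto simp: coeff_monom split: if_splits)
      then show "set_mset k \<subseteq> X" using m(1) n(1) mult.IH by auto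
    qed
  qed (fastforce simp: gen_eq_monom coeff_monom simp flip: monom_empty split: if_splits)+
next
  assume p: "\<forall>m. coeff p m \<noteq> 0 \<longrightarrow> set_mset m \<subseteq> X"
  have monom: "monom m \<in> subalg (gen ` X)" if "admissible m" "set_mset m \<subseteq> X" for m
    using that
  proof (induction m)
    case (add x m)
    let ?s = "koszul {#x#} m"
    have adm: "admissible ({#x#} + m)" using add.prems by simp
    then have s: "?s * ?s = 1" by (simp add: koszul_def flip: power_mult_distrib)
    have "gen x * monom m \<in> subalg (gen ` X)"
      using add admissible_add[OF adm] by (intro subalg.mult) (auto intro: subalg.base)
    then have "qscale ?s (qscale ?s (monom ({#x#} + m))) \<in> subalg (gen ` X)"
      unfolding gen_eq_monom monom_mult by (rule subalg.scale)
    then show ?case using s by simp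
  qed (simp add: monom_empty subalg.one)
  have "(\<Sum>m\<in>M. qscale (coeff p m) (monom m)) \<in> subalg (gen ` X)"
    if "finite M" "M \<subseteq> {m. coeff p m \<noteq> 0}" for M
    using that
  proof (induction M)
    case empty
    show ?case using subalg.scale[OF subalg.one, of 0] by simp
  next
    case (insert m M)
    then show ?case
      using p coeff_admissible[of p m] by (auto intro!: subalg.add subalg.scale monom)
  qed
  from this[OF finite_coeff order_refl] show "p \<in> \<Lambda> X"
    by (simp add: sum_monom \<Lambda>_def)
qed


section \<open>Differential graded algebras and minimal models\<close>

text \<open>
  \<open>differential X d\<close>: \<open>d\<close> is a derivation of degree 1 on the free algebra on \<open>X\<close>, of square zero.
  The values of \<open>d\<close> outside that algebra are irrelevant here and in all later notions.
\<close>

definition differential :: "gen set \<Rightarrow> (gca \<Rightarrow> gca) \<Rightarrow> bool" where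
  "differential X d \<longleftrightarrow>
     (\<forall>x\<in>\<Lambda> X. d x \<in> \<Lambda> X) \<and>
     (\<forall>x\<in>\<Lambda> X. \<forall>y\<in>\<Lambda> X. d (x + y) = d x + d y) \<and>
     (\<forall>c. \<forall>x\<in>\<Lambda> X. d (qscale c x) = qscale c (d x)) \<and>
     (\<forall>k. \<forall>x\<in>\<Lambda> X \<inter> homogeneous k. d x \<in> homogeneous (k + 1)) \<and>
     (\<forall>k. \<forall>x\<in>\<Lambda> X \<inter> homogeneous k. \<forall>y\<in>\<Lambda> X. d (x * y) = d x * y + (-1) ^ k * x * d y) \<and>
     (\<forall>x\<in>\<Lambda> X. d (d x) = 0)"

definition minimal_model :: "gen set \<Rightarrow> (gca \<Rightarrow> gca) \<Rightarrow> bool" where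
  "minimal_model W d \<longleftrightarrow>
     (\<forall>w\<in>W. gdeg w \<ge> 2) \<and> differential W d \<and>
     (\<forall>w\<in>lin W. \<forall>x. coeff (d w) {#x#} = 0)"

definition cocycles :: "gen set \<Rightarrow> (gca \<Rightarrow> gca) \<Rightarrow> gca set" where
  "cocycles X d = {x \<in> \<Lambda> X. d x = 0}"

definition coboundaries :: "gen set \<Rightarrow> (gca \<Rightarrow> gca) \<Rightarrow> gca set" where
  "coboundaries X d = d ` \<Lambda> X"

text \<open>
  The quotient of cocycles by coboundaries is spanned by finitely many classes.
\<close>

definition finite_dim_cohomology :: "gen set \<Rightarrow> (gca \<Rightarrow> gca) \<Rightarrow> bool" where
  "finite_dim_cohomology X d \<longleftrightarrow>
     (\<exists>B. finite B \<and> B \<subseteq> cocycles X d \<and>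
        (\<forall>z\<in>cocycles X d. \<exists>y\<in>Q.span B. z - y \<in> coboundaries X d))"

definition elliptic :: "gen set \<Rightarrow> (gca \<Rightarrow> gca) \<Rightarrow> bool" where
  "elliptic W d \<longleftrightarrow> minimal_model W d \<and> finite W \<and> finite_dim_cohomology W d"

definition dga_iso ::
  "gen set \<Rightarrow> (gca \<Rightarrow> gca) \<Rightarrow> gen set \<Rightarrow> (gca \<Rightarrow> gca) \<Rightarrow> (gca \<Rightarrow> gca) \<Rightarrow> bool" where
  "dga_iso X d X' d' f \<longleftrightarrow>
     bij_betw f (\<Lambda> X) (\<Lambda> X') \<and>
     (\<forall>x\<in>\<Lambda> X. \<forall>y\<in>\<Lambda> X. f (x + y) = f x + f y) \<and>
     (\<forall>c. \<forall>x\<in>\<Lambda> X. f (qscale c x) = qscale c (f x)) \<and>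
     f 1 = 1 \<and>
     (\<forall>x\<in>\<Lambda> X. \<forall>y\<in>\<Lambda> X. f (x * y) = f x * f y) \<and>
     (\<forall>k. \<forall>x\<in>\<Lambda> X \<inter> homogeneous k. f x \<in> homogeneous k) \<and>
     (\<forall>x\<in>\<Lambda> X. f (d x) = d' (f x))"

definition two_stage :: "gen set \<Rightarrow> gen set \<Rightarrow> (gca \<Rightarrow> gca) \<Rightarrow> bool" where
  "two_stage U V d \<longleftrightarrow>
     U \<inter> V = {} \<and> minimal_model (U \<union> V) d \<and>
     (\<forall>x\<in>lin U. d x = 0) \<and> (\<forall>x\<in>lin V. d x \<in> \<Lambda> U)"

text \<open>
  The dimension of the space spanned by a finite set of generators is the cardinality of that set.
  Only finite sets matter: a minimal model isomorphic to one on finitely many generators has itself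
  finitely many generators.
\<close>

definition displays_max_dim :: "gen set \<Rightarrow> gen set \<Rightarrow> (gca \<Rightarrow> gca) \<Rightarrow> bool" where
  "displays_max_dim U V d \<longleftrightarrow>
     (\<forall>U' V' d'. two_stage U' V' d' \<and> (\<exists>f. dga_iso (U \<union> V) d (U' \<union> V') d' f)
        \<longrightarrow> card V' \<le> card V)"

definition connected_gr :: "nat \<Rightarrow> gen set \<Rightarrow> bool" where
  "connected_gr n Z \<longleftrightarrow> (\<forall>i\<le>n. {z \<in> Z. gdeg z = i} = {})"

definition coconnected_gr :: "nat \<Rightarrow> gen set \<Rightarrow> bool" where
  "coconnected_gr n Z \<longleftrightarrow> (\<forall>i\<ge>n. {z \<in> Z. gdeg z = i} = {})"


section \<open>Rational toral rank\<close>

text \<open>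
  The algebra \<open>\<Lambda> (A \<union> W)\<close> plays the role of the tensor product of \<open>\<Lambda> A\<close> and \<open>\<Lambda> W\<close>.
  The ordered homogeneous basis \<open>w\<close> of the space spanned by \<open>W\<close> need not consist of elements of \<open>W\<close>.
\<close>

definition ks_extension :: "gen set \<Rightarrow> gen set \<Rightarrow> (gca \<Rightarrow> gca) \<Rightarrow> (gca \<Rightarrow> gca) \<Rightarrow> bool" where
  "ks_extension A W d D \<longleftrightarrow>
     A \<inter> W = {} \<and> differential (A \<union> W) D \<and>
     (\<forall>a\<in>A. D (gen a) = 0) \<and>
     (\<forall>x\<in>\<Lambda> W. D x - d x \<in> ideal_in (\<Lambda> (A \<union> W)) (gen ` A)) \<and>
     (\<exists>(I :: nat set) w.
        inj_on w I \<and> Q.independent (w ` I) \<and> Q.span (w ` I) = lin W \<and>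
        (\<forall>i\<in>I. \<exists>k. w i \<in> homogeneous k) \<and>
        (\<forall>i\<in>I. D (w i) \<in> subalg (gen ` A \<union> w ` {j \<in> I. j < i})))"

definition toral_ext :: "gen set \<Rightarrow> (gca \<Rightarrow> gca) \<Rightarrow> nat \<Rightarrow> bool" where
  "toral_ext W d n \<longleftrightarrow>
     (\<exists>A D. finite A \<and> card A = n \<and> (\<forall>a\<in>A. gdeg a = 2) \<and>
        ks_extension A W d D \<and> finite_dim_cohomology (A \<union> W) D)"

text \<open>A supremum in \<open>enat\<close>, so that no value is made up if there is no largest such \<open>n\<close>.\<close>

definition rk0 :: "gen set \<Rightarrow> (gca \<Rightarrow> gca) \<Rightarrow> enat" where
  "rk0 W d = Sup (enat ` {n. toral_ext W d n})"

end

theory Submission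
  imports Defs "HOL-Library.FuncSet"
begin

text \<open>
  Let \<open>D\<close> be the differential of an extension of \<open>\<Lambda>(U, V)\<close> by \<open>n\<close> generators \<open>A\<close> of degree 2 whose
  total cohomology is finite-dimensional.

  The degree hypotheses control the shape of \<open>D\<close>.  A monomial of even degree that involves \<open>A\<close> and
  some generator of \<open>W = U \<union> V\<close> involves at least two odd generators, so its degree is at least
  \<open>2 + 2r\<close>, and at least \<open>2 + r + s\<close> if one of them lies in \<open>V\<close>.  These bounds exceed the degrees of
  \<open>D u\<close> and \<open>D v\<close>, respectively.  On monomials without \<open>A\<close> the coefficients of \<open>D\<close> are those of \<open>d\<close>.
  Hence \<open>D u \<in> \<Lambda> A\<close> for \<open>u \<in> U\<close>, and \<open>D v \<in> \<Lambda> (A \<union> U)\<close> for \<open>v \<in> V\<close>.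

  On \<open>\<Lambda> (A \<union> U)\<close> the differential is therefore \<open>\<Sum>u\<in>U. D u * \<partial>\<^sub>u\<close>, where \<open>\<partial>\<^sub>u\<close> is contraction by \<open>u\<close>.
  The key point is that maximality of \<open>V\<close> forces \<open>D u = 0\<close> for all \<open>u \<in> U\<close>
  (\<open>base_differential_vanishes\<close>).  Suppose \<open>D u = 0\<close> in degrees below \<open>k\<close>.  In \<open>D (D v) = 0\<close> the part of
  degree \<open>k + 1\<close> in \<open>A\<close> is \<open>\<Sum>|u|=k. D u * \<partial>\<^sub>u (d v)\<close>.  Taking the coefficient of a monomial \<open>a\<close>
  in \<open>A\<close> turns \<open>u \<mapsto> D u\<close> into a linear functional on the degree \<open>k\<close> part of \<open>U\<close>, and contraction
  along this functional kills \<open>d v\<close> for every \<open>v \<in> V\<close>.  If it were nonzero, then after a change of basis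
  some element \<open>u\<close> of \<open>U\<close> would not occur in \<open>d V\<close>, so \<open>u\<close> could be moved from \<open>U\<close> to \<open>V\<close>,
  contradicting maximality (\<open>maximal_stage_detects_functionals\<close>).

  Now set all generators in \<open>W\<close> to zero.  A coboundary is sent to the ideal of the polynomial
  ring \<open>\<rat>[A]\<close> generated by the images of the \<open>D v\<close> with \<open>v \<in> V\<close>.  Finite-dimensional cohomology makes this ideal
  contain all monomials of high degree, and a polynomial ring modulo an ideal with \<open>m\<close> generators
  can be finite-dimensional only if it has at most \<open>m\<close> variables (\<open>variables_le_generators\<close>).
  Hence \<open>n \<le> dim V\<close>.
\<close>


section \<open>Calculus in free graded commutative algebras\<close>

lemma qscale_mult_left: "qscale c x * y = qscale c (x * y)"
  by transfer (rule tmul_map_left)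

lemma qscale_mult_right: "x * qscale c y = qscale c (x * y)"
  by transfer (rule tmul_map_right)

lemma coeff_diff [simp]: "coeff (p - q) m = coeff p m - coeff q m"
  by transfer (rule lookup_minus)

lemma minus_one_power_mult: "(-1 :: gca) ^ k * x = qscale ((-1) ^ k) x"
  by (simp add: minus_one_power_iff)

lemma gca_induct [case_names zero monom add]:
  assumes "P 0" "\<And>c m. admissible m \<Longrightarrow> coeff p m \<noteq> 0 \<Longrightarrow> P (qscale c (monom m))"
    "\<And>x y. P x \<Longrightarrow> P y \<Longrightarrow> P (x + y)"
  shows "P p"
proof -
  have "P (\<Sum>m\<in>M. qscale (coeff p m) (monom m))" if "finite M" "M \<subseteq> {m. coeff p m \<noteq> 0}" for M
    using that by (induction M) (auto intro: assms coeff_admissible)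
  from this[OF finite_coeff order_refl] show ?thesis by (simp add: sum_monom)
qed

lemma add_nonzeroD: "a + b \<noteq> 0 \<Longrightarrow> a \<noteq> 0 \<or> b \<noteq> (0::rat)"
  by auto

lemma subspace_Lambda: "Q.subspace (\<Lambda> X)"
  by (auto simp: Q.subspace_def mem_Lambda_iff dest!: add_nonzeroD) blast+

lemma mult_in_Lambda: "x \<in> \<Lambda> X \<Longrightarrow> y \<in> \<Lambda> X \<Longrightarrow> x * y \<in> \<Lambda> X"
  unfolding \<Lambda>_def by (rule subalg.mult)

lemma one_in_Lambda: "1 \<in> \<Lambda> X"
  unfolding \<Lambda>_def by (rule subalg.one)

lemma gen_in_Lambda: "x \<in> X \<Longrightarrow> gen x \<in> \<Lambda> X"
  unfolding \<Lambda>_def by (intro subalg.base imageI)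

lemma Lambda_mono: "X \<subseteq> Y \<Longrightarrow> \<Lambda> X \<subseteq> \<Lambda> Y"
  unfolding subset_iff mem_Lambda_iff by blast

lemma Lambda_UNIV: "x \<in> \<Lambda> UNIV"
  by (simp add: mem_Lambda_iff)

lemma gen_in_lin: "x \<in> X \<Longrightarrow> gen x \<in> lin X"
  unfolding lin_def by (intro Q.span_base imageI)

lemma monom_in_Lambda: "set_mset m \<subseteq> X \<Longrightarrow> monom m \<in> \<Lambda> X"
  by (auto simp: mem_Lambda_iff coeff_monom split: if_splits)

lemma koszul_square: "admissible (m + n) \<Longrightarrow> koszul m n * koszul m n = 1"
  by (simp add: koszul_def flip: power_mult_distrib)

lemma monom_add_mset:
  assumes "admissible (add_mset x m)"
  shows "monom (add_mset x m) = qscale (koszul {#x#} m) (gen x * monom m)"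
  using assms koszul_square[of "{#x#}" m] by (simp add: gen_eq_monom monom_mult)

text \<open>
  Every element is built from 1 by multiplying with one generator on the left, adding and scaling, so
  identities between linear operators need only be checked against left multiplication by a generator.
\<close>
lemma Lambda_induct [consumes 1, case_names one gen add scale]:
  assumes "p \<in> \<Lambda> X" and one: "P 1"
    and gen: "\<And>x p. x \<in> X \<Longrightarrow> p \<in> \<Lambda> X \<Longrightarrow> P p \<Longrightarrow> P (gen x * p)"
    and add: "\<And>p q. p \<in> \<Lambda> X \<Longrightarrow> q \<in> \<Lambda> X \<Longrightarrow> P p \<Longrightarrow> P q \<Longrightarrow> P (p + q)"
    and scale: "\<And>c p. p \<in> \<Lambda> X \<Longrightarrow> P p \<Longrightarrow> P (qscale c p)"
  shows "P p"
proof -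
  have P_monom: "P (monom m)" if "admissible m" "set_mset m \<subseteq> X" for m
    using that
  proof (induction m)
    case (add x m)
    then have "admissible m" using admissible_add[of "{#x#}" m] by simp
    then show ?case
      using add by (simp add: monom_add_mset scale gen monom_in_Lambda gen_in_Lambda mult_in_Lambda)
  qed (simp add: monom_empty one)
  have "p \<in> \<Lambda> X \<and> P p"
  proof (induction p rule: gca_induct)
    case zero
    then show ?case using scale[OF one_in_Lambda one, of 0] subspace_Lambda by (simp add: Q.subspace_0)
  next
    case (monom c m)
    then have "set_mset m \<subseteq> X" using assms(1) by (auto simp: mem_Lambda_iff)
    then show ?case
      using P_monom monom by (simp add: scale monom_in_Lambda Q.subspace_scale[OF subspace_Lambda])
  next
    case (add x y)
    then show ?case using assms(4) by (simp add: Q.subspace_add[OF subspace_Lambda])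
  qed
  then show ?thesis ..
qed

lemma coeff_monom_times:
  "coeff (monom m * y) k = (if m \<subseteq># k then koszul m (k - m) * coeff y (k - m) else 0)"
proof (induction y rule: gca_induct)
  case (monom c n)
  show ?case
    by (auto simp: qscale_mult_right monom_mult coeff_monom koszul_def subset_mset.add_diff_inverse
        dest: admissible_add)
       (metis mset_subset_eq_add_left)
qed (auto simp: distrib_left)

lemma coeff_gen_times:
  "coeff (gen x * y) k = (if x \<in># k then koszul {#x#} (k - {#x#}) * coeff y (k - {#x#}) else 0)"
  by (simp add: gen_eq_monom coeff_monom_times)

lemma times_eq_sum_monom: "x * y = (\<Sum>m | coeff x m \<noteq> 0. qscale (coeff x m) (monom m * y))"
proof -
  have "x * y = (\<Sum>m | coeff x m \<noteq> 0. qscale (coeff x m) (monom m)) * y" by (simp add: sum_monom)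
  then show ?thesis by (simp add: sum_distrib_right qscale_mult_left)
qed

lemma coeff_times:
  "coeff (x * y) k = (\<Sum>m | coeff x m \<noteq> 0 \<and> m \<subseteq># k. coeff x m * koszul m (k - m) * coeff y (k - m))"
proof -
  have "coeff (x * y) k = (\<Sum>m | coeff x m \<noteq> 0.
      if m \<subseteq># k then coeff x m * koszul m (k - m) * coeff y (k - m) else 0)"
    unfolding times_eq_sum_monom[of x y] coeff_sum by (intro sum.cong) (auto simp: coeff_monom_times)
  also have "\<dots> = (\<Sum>m\<in>{m. coeff x m \<noteq> 0} \<inter> {m. m \<subseteq># k}. coeff x m * koszul m (k - m) * coeff y (k - m))"
    using finite_coeff by (subst sum.inter_restrict) auto
  finally show ?thesis by (simp add: Collect_conj_eq)
qed

lemma coeff_times_nonzero: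
  assumes "coeff (x * y) k \<noteq> 0"
  obtains m n where "k = m + n" "coeff x m \<noteq> 0" "coeff y n \<noteq> 0"
proof -
  obtain m where "coeff x m \<noteq> 0" "m \<subseteq># k" "coeff x m * koszul m (k - m) * coeff y (k - m) \<noteq> 0"
    using sum.not_neutral_contains_not_neutral[OF assms[unfolded coeff_times]] by blast
  then show ?thesis using that[of m "k - m"] by simp
qed

lemma mdeg_add [simp]: "mdeg (m + n) = mdeg m + mdeg n"
  by (simp add: mdeg_def)

lemma mdeg_add_mset [simp]: "mdeg (add_mset x m) = gdeg x + mdeg m"
  by (simp add: mdeg_def)

lemma mdeg_empty [simp]: "mdeg {#} = 0"
  by (simp add: mdeg_def)

lemma homogeneousD: "p \<in> homogeneous k \<Longrightarrow> coeff p m \<noteq> 0 \<Longrightarrow> mdeg m = k"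
  by (simp add: homogeneous_def)

lemma subspace_homogeneous: "Q.subspace (homogeneous k)"
  by (auto simp: Q.subspace_def homogeneous_def dest!: add_nonzeroD)

lemma gen_homogeneous: "gen x \<in> homogeneous (gdeg x)"
  by (simp add: homogeneous_def gen_eq_monom coeff_monom)

lemma monom_homogeneous: "monom m \<in> homogeneous (mdeg m)"
  by (simp add: homogeneous_def coeff_monom)

lemma gen_times_gen_odd:
  "odd (gdeg u) \<Longrightarrow> gen x * (gen u * p) = qscale ((-1) ^ gdeg x) (gen u * (gen x * p))"
  using graded_commutative[OF gen_homogeneous[of x] gen_homogeneous[of u]]
  by (simp add: power_mult qscale_mult_left minus_one_power_iff flip: mult.assoc)

lemma gen_square_odd: "odd (gdeg u) \<Longrightarrow> gen u * (gen u * p) = 0"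
  by (simp add: gen_eq_monom monom_mult koszul_def admissible_def flip: mult.assoc)

lemma
  assumes "differential X d"
  shows differential_in_Lambda: "x \<in> \<Lambda> X \<Longrightarrow> d x \<in> \<Lambda> X"
    and differential_add: "x \<in> \<Lambda> X \<Longrightarrow> y \<in> \<Lambda> X \<Longrightarrow> d (x + y) = d x + d y"
    and differential_qscale: "x \<in> \<Lambda> X \<Longrightarrow> d (qscale c x) = qscale c (d x)"
    and differential_homogeneous: "x \<in> \<Lambda> X \<Longrightarrow> x \<in> homogeneous k \<Longrightarrow> d x \<in> homogeneous (k + 1)"
    and differential_times: "x \<in> \<Lambda> X \<Longrightarrow> x \<in> homogeneous k \<Longrightarrow> y \<in> \<Lambda> X
      \<Longrightarrow> d (x * y) = d x * y + qscale ((-1) ^ k) (x * d y)"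
    and differential_square: "x \<in> \<Lambda> X \<Longrightarrow> d (d x) = 0"
  using assms unfolding differential_def by (auto simp: qscale_mult_left minus_one_power_mult)

lemma differential_one:
  assumes D: "differential X D"
  shows "D 1 = 0"
proof -
  have "D (1 * 1) = D 1 * 1 + qscale ((-1) ^ 0) (1 * D 1)"
    using monom_homogeneous[of "{#}"]
    by (intro differential_times[OF D]) (simp_all add: one_in_Lambda monom_empty)
  then show ?thesis by simp
qed

lemma differential_eq_sum_monom:
  assumes D: "differential X D" and x: "x \<in> \<Lambda> X"
  shows "D x = (\<Sum>m | coeff x m \<noteq> 0. qscale (coeff x m) (D (monom m)))"
proof -
  have "(\<Sum>m\<in>M. qscale (coeff x m) (monom m)) \<in> \<Lambda> X \<and>
      D (\<Sum>m\<in>M. qscale (coeff x m) (monom m)) = (\<Sum>m\<in>M. qscale (coeff x m) (D (monom m)))"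
    if "finite M" "M \<subseteq> {m. coeff x m \<noteq> 0}" for M
    using that
  proof (induction M)
    case empty
    have "D (qscale 0 0) = qscale 0 (D 0)"
      by (rule differential_qscale[OF D]) (rule Q.subspace_0[OF subspace_Lambda])
    then show ?case by (simp add: Q.subspace_0[OF subspace_Lambda])
  next
    case (insert m M)
    have m: "monom m \<in> \<Lambda> X"
      using insert.prems x by (intro monom_in_Lambda) (auto simp: mem_Lambda_iff)
    then show ?case
      using insert Q.subspace_scale[OF subspace_Lambda m] Q.subspace_add[OF subspace_Lambda]
      by (simp add: differential_add[OF D] differential_qscale[OF D])
  qed
  from this[OF finite_coeff order_refl] show ?thesis by (simp add: sum_monom)
qed

section \<open>Contraction by odd generators\<close>

text \<open>
  For odd \<open>u\<close> this is the partial derivative \<open>\<partial>\<^sub>u\<close> from the left.  Each monomial containing \<open>u\<close> is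
  written as \<open>\<plusminus> u * n\<close> and contributes \<open>\<plusminus> n\<close>.
\<close>
definition contract :: "gen \<Rightarrow> gca \<Rightarrow> gca" where
  "contract u p = (\<Sum>n | coeff p n \<noteq> 0 \<and> u \<in># n.
     qscale (koszul {#u#} (n - {#u#}) * coeff p n) (monom (n - {#u#})))"

lemma coeff_contract: "coeff (contract u p) m = koszul {#u#} m * coeff p (add_mset u m)"
proof -
  have "coeff (contract u p) m = (\<Sum>n | coeff p n \<noteq> 0 \<and> u \<in># n.
      if n = add_mset u m then koszul {#u#} m * coeff p (add_mset u m) else 0)"
    unfolding contract_def coeff_sum
  proof (intro sum.cong refl)
    fix n assume "n \<in> {n. coeff p n \<noteq> 0 \<and> u \<in># n}"
    then obtain n' where n: "n = add_mset u n'" "admissible n"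
      by (auto dest: coeff_admissible multi_member_split)
    then have "admissible n'" using admissible_add[of "{#u#}" n'] by simp
    then show "coeff (qscale (koszul {#u#} (n - {#u#}) * coeff p n) (monom (n - {#u#}))) m
        = (if n = add_mset u m then koszul {#u#} m * coeff p (add_mset u m) else 0)"
      using n by (auto simp: coeff_monom)
  qed
  also have "\<dots> = koszul {#u#} m * coeff p (add_mset u m)"
  proof -
    have "finite {n. coeff p n \<noteq> 0 \<and> u \<in># n}"
      by (rule finite_subset[OF _ finite_coeff[of p]]) auto
    then show ?thesis by auto
  qed
  finally show ?thesis .
qed

lemma contract_add: "contract u (p + q) = contract u p + contract u q"
  by (rule gca_eqI) (simp add: coeff_contract distrib_left)

lemma contract_qscale: "contract u (qscale c p) = qscale c (contract u p)"
  by (rule gca_eqI) (simp add: coeff_contract)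

lemma contract_one: "contract u 1 = 0"
  by (rule gca_eqI) (simp add: coeff_contract coeff_monom flip: monom_empty)

lemma contract_in_Lambda: "p \<in> \<Lambda> X \<Longrightarrow> contract u p \<in> \<Lambda> X"
  by (fastforce simp: mem_Lambda_iff coeff_contract)

text \<open>
  Removing \<open>u\<close> and putting it back on the left introduces the same Koszul sign twice, so
  \<open>p - gen u * contract u p\<close> is the part of \<open>p\<close> without \<open>u\<close>.
\<close>
lemma coeff_gen_contract:
  "coeff (gen u * contract u p) m = (if u \<in># m then coeff p m else 0)"
proof (cases "coeff p m = 0")
  case False
  then have "admissible m" by (rule coeff_admissible)
  then have "koszul {#u#} (m - {#u#}) * koszul {#u#} (m - {#u#}) = 1" if "u \<in># m"
    using that by (intro koszul_square) simp
  then show ?thesis by (simp add: coeff_gen_times coeff_contract flip: mult.assoc)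
qed (simp add: coeff_gen_times coeff_contract)

text \<open>
  The antiderivation rule, in the form used with \<open>Lambda_induct\<close>.  For \<open>y \<noteq> u\<close> the sign comes from the associativity
  of the Koszul signs: moving \<open>u\<close> past \<open>y\<close> costs \<open>(-1)^|y|\<close> because \<open>u\<close> is odd.
\<close>
lemma contract_gen_times:
  assumes u: "odd (gdeg u)"
  shows "contract u (gen y * p) = (if y = u then p else 0) + qscale ((-1) ^ gdeg y) (gen y * contract u p)"
proof (rule gca_eqI)
  fix m
  show "coeff (contract u (gen y * p)) m
    = coeff ((if y = u then p else 0) + qscale ((-1) ^ gdeg y) (gen y * contract u p)) m"
  proof (cases "y = u")
    case True
    show ?thesis
    proof (cases "admissible m")
      case adm: True
      have "u \<in># m \<Longrightarrow> koszul {#u#} m = 0"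
        using u by (auto simp: koszul_def admissible_def intro!: exI[of _ u])
      moreover have "admissible (add_mset u m)" if "u \<notin># m"
        using adm that by (auto simp: admissible_def not_in_iff)
      then have "koszul {#u#} m * koszul {#u#} m = 1" if "u \<notin># m"
        using that by (intro koszul_square) simp
      ultimately show ?thesis
        using True u
        by (simp add: coeff_contract coeff_gen_times[of u p] coeff_gen_contract flip: mult.assoc)
    next
      case False
      then have "coeff p m = 0" using coeff_admissible by blast
      then show ?thesis
        using True by (simp add: coeff_contract coeff_gen_times coeff_gen_contract)
    qed
  next
    case False
    show ?thesis
    proof (cases "y \<in># m")
      case True
      then obtain n where m: "m = add_mset y n" by (auto dest: multi_member_split)
      have "koszul {#u#} (add_mset y n) * koszul {#y#} (add_mset u n) * coeff p (add_mset u n)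
        = (-1) ^ gdeg y * (koszul {#y#} n * koszul {#u#} n) * coeff p (add_mset u n)"
      proof (cases "coeff p (add_mset u n) = 0")
        case nz: False
        have swap: "koszul {#y#} {#u#} = (-1) ^ gdeg y * koszul {#u#} {#y#}"
          using koszul_swap[of "{#y#}" "{#u#}"] u by (simp add: mdeg_def minus_one_power_iff)
        have adm: "admissible (add_mset u n)" using nz by (rule coeff_admissible)
        show ?thesis
        proof (cases "admissible (add_mset u (add_mset y n))")
          case True
          have sq: "koszul {#u#} {#y#} * koszul {#u#} {#y#} = 1" "koszul {#y#} n * koszul {#y#} n = 1"
            "koszul {#u#} n * koszul {#u#} n = 1" "koszul {#u, y#} n * koszul {#u, y#} n = 1"
            using True admissible_add[of "{#u, y#}" n] admissible_add[of "{#u#}" "add_mset y n"] adm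
            by (auto intro!: koszul_square simp: add_mset_commute)
          have "koszul {#u#} (add_mset y n) * koszul {#y#} n = koszul {#u#} {#y#} * koszul {#u, y#} n"
            "koszul {#y#} (add_mset u n) * koszul {#u#} n = koszul {#y#} {#u#} * koszul {#u, y#} n"
            using koszul_assoc[of "{#u#}" "{#y#}" n] koszul_assoc[of "{#y#}" "{#u#}" n]
            by (simp_all add: add_mset_commute)
          then have "koszul {#u#} (add_mset y n) = koszul {#u#} {#y#} * koszul {#u, y#} n * koszul {#y#} n"
            "koszul {#y#} (add_mset u n) = koszul {#y#} {#u#} * koszul {#u, y#} n * koszul {#u#} n"
            using sq by (metis mult.assoc mult_1_right)+
          then have "koszul {#u#} (add_mset y n) * koszul {#y#} (add_mset u n)
            = (-1) ^ gdeg y * (koszul {#u#} {#y#} * koszul {#u#} {#y#}) *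
              (koszul {#u, y#} n * koszul {#u, y#} n) * (koszul {#y#} n * koszul {#u#} n)"
            unfolding swap by (simp only: ac_simps)
          then show ?thesis by (simp only: sq mult_1_right)
        next
          case inadm: False
          then have "koszul {#u#} (add_mset y n) = 0"
            by (simp add: koszul_def add_mset_commute)
          moreover have "\<not> admissible (add_mset y n)"
          proof -
            obtain z where z: "odd (gdeg z)" "count (add_mset u (add_mset y n)) z > 1"
              using inadm by (auto simp: admissible_def not_le)
            have "count (add_mset u n) z \<le> 1" using adm z(1) unfolding admissible_def by blast
            then have "z = y" using z(2) by (auto split: if_splits)
            then show ?thesis using z False by (auto simp: admissible_def intro!: exI[of _ y])
          qed
          then have "koszul {#y#} n = 0" by (simp add: koszul_def)
          ultimately show ?thesis by simp
        qed
      qed simp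
      then show ?thesis using False by (simp add: m coeff_contract coeff_gen_times add_mset_commute ac_simps)
    qed (use False in \<open>simp add: coeff_contract coeff_gen_times\<close>)
  qed
qed

text \<open>
  Contraction by the linear functional on the span of \<open>Y\<close> that takes the value \<open>\<theta> y\<close> at \<open>y\<close>.
\<close>
definition contract_along :: "(gen \<Rightarrow> rat) \<Rightarrow> gen set \<Rightarrow> gca \<Rightarrow> gca" where
  "contract_along \<theta> Y p = (\<Sum>y\<in>Y. qscale (\<theta> y) (contract y p))"

lemma contract_along_add: "contract_along \<theta> Y (p + q) = contract_along \<theta> Y p + contract_along \<theta> Y q"
  by (simp add: contract_along_def contract_add Q.scale_right_distrib sum.distrib)

lemma contract_along_qscale: "contract_along \<theta> Y (qscale c p) = qscale c (contract_along \<theta> Y p)"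
  by (simp add: contract_along_def contract_qscale Q.scale_sum_right mult.commute)

lemma contract_along_one: "contract_along \<theta> Y 1 = 0"
  by (simp add: contract_along_def contract_one)

lemma contract_along_in_Lambda: "p \<in> \<Lambda> X \<Longrightarrow> contract_along \<theta> Y p \<in> \<Lambda> X"
  unfolding contract_along_def
  by (intro Q.subspace_sum Q.subspace_scale subspace_Lambda contract_in_Lambda)

lemma contract_along_gen_times:
  assumes "finite Y" "\<forall>y\<in>Y. odd (gdeg y)"
  shows "contract_along \<theta> Y (gen x * p)
    = (if x \<in> Y then qscale (\<theta> x) p else 0) + qscale ((-1) ^ gdeg x) (gen x * contract_along \<theta> Y p)"
proof -
  have "contract_along \<theta> Y (gen x * p) = (\<Sum>y\<in>Y. (if x = y then qscale (\<theta> y) p else 0)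
      + qscale ((-1) ^ gdeg x) (gen x * qscale (\<theta> y) (contract y p)))"
    unfolding contract_along_def using assms(2)
    by (intro sum.cong)
      (auto simp: contract_gen_times Q.scale_right_distrib qscale_mult_right mult.commute)
  also have "\<dots> = (if x \<in> Y then qscale (\<theta> x) p else 0) + qscale ((-1) ^ gdeg x) (gen x * contract_along \<theta> Y p)"
    using assms(1) by (simp add: sum.distrib contract_along_def Q.scale_sum_right sum_distrib_left)
  finally show ?thesis .
qed

lemma gen_contract_along_homogeneous:
  assumes "\<forall>y\<in>Y. gdeg y = gdeg u" "p \<in> homogeneous k"
  shows "gen u * contract_along \<theta> Y p \<in> homogeneous k"
  unfolding contract_along_def sum_distrib_left qscale_mult_right
proof (intro Q.subspace_sum Q.subspace_scale subspace_homogeneous)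
  fix y assume "y \<in> Y"
  then show "gen u * contract y p \<in> homogeneous k"
    using assms by (auto simp: homogeneous_def coeff_gen_times coeff_contract dest!: multi_member_split split: if_splits)
qed

section \<open>Shear automorphisms and maximal second stages\<close>

text \<open>
  The algebra automorphism that sends \<open>y \<in> Y\<close> to \<open>y + \<theta> y * u\<close> and fixes the other generators, provided that
  \<open>u \<notin> Y\<close> and all these generators are odd.  It is the exponential of the derivation
  \<open>p \<mapsto> u * \<partial>\<^sub>\<theta> p\<close>, which has square zero because \<open>u * u = 0\<close>; hence only two terms appear.
\<close>
definition shear :: "gen \<Rightarrow> (gen \<Rightarrow> rat) \<Rightarrow> gen set \<Rightarrow> gca \<Rightarrow> gca" where
  "shear u \<theta> Y p = p + gen u * contract_along \<theta> Y p"

lemma shear_add: "shear u \<theta> Y (p + q) = shear u \<theta> Y p + shear u \<theta> Y q"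
  by (simp add: shear_def contract_along_add distrib_left)

lemma shear_qscale: "shear u \<theta> Y (qscale c p) = qscale c (shear u \<theta> Y p)"
  by (simp add: shear_def contract_along_qscale qscale_mult_right Q.scale_right_distrib)

lemma shear_zero: "shear u \<theta> Y 0 = 0"
  using shear_qscale[of u \<theta> Y 0 0] by simp

lemma shear_one: "shear u \<theta> Y 1 = 1"
  by (simp add: shear_def contract_along_one)

lemma shear_in_Lambda: "u \<in> X \<Longrightarrow> p \<in> \<Lambda> X \<Longrightarrow> shear u \<theta> Y p \<in> \<Lambda> X"
  unfolding shear_def
  by (intro Q.subspace_add subspace_Lambda mult_in_Lambda gen_in_Lambda contract_along_in_Lambda)

lemma shear_homogeneous:
  "\<forall>y\<in>Y. gdeg y = gdeg u \<Longrightarrow> p \<in> homogeneous k \<Longrightarrow> shear u \<theta> Y p \<in> homogeneous k"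
  unfolding shear_def by (intro Q.subspace_add subspace_homogeneous gen_contract_along_homogeneous)

context
  fixes u :: gen and \<theta> :: "gen \<Rightarrow> rat" and Y :: "gen set"
  assumes u: "odd (gdeg u)" "u \<notin> Y" and Y: "finite Y" "\<forall>y\<in>Y. odd (gdeg y)"
begin

lemma shear_gen_times: "shear u \<theta> Y (gen x * p) = (gen x + qscale (if x \<in> Y then \<theta> x else 0) (gen u)) * shear u \<theta> Y p"
  using u(1) gen_times_gen_odd[OF u(1), of x] gen_square_odd[OF u(1)]
  by (auto simp: shear_def contract_along_gen_times[OF Y] distrib_left distrib_right qscale_mult_left
      qscale_mult_right mult.assoc add_ac)

lemma shear_mult: "shear u \<theta> Y (p * q) = shear u \<theta> Y p * shear u \<theta> Y q"
  using Lambda_UNIV[of p]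
  by (induction rule: Lambda_induct)
    (simp_all add: shear_one shear_gen_times mult.assoc distrib_right shear_add shear_qscale qscale_mult_left)

lemma shear_gen: "shear u \<theta> Y (gen x) = gen x + qscale (if x \<in> Y then \<theta> x else 0) (gen u)"
  using shear_gen_times[of x 1] by (simp add: shear_one)

text \<open>
  Exponentials of opposite derivations are inverse to each other.
\<close>
lemma shear_inverse: "shear u \<theta> Y (shear u (\<lambda>y. - \<theta> y) Y p) = p"
proof -
  have neg: "contract_along (\<lambda>y. - \<theta> y) Y p = - contract_along \<theta> Y p"
    by (simp add: contract_along_def sum_negf)
  have "contract_along \<theta> Y (gen u * q) = - (gen u * contract_along \<theta> Y q)" for q
    using u contract_along_gen_times[OF Y, of \<theta> u q] by simp
  then have "gen u * contract_along \<theta> Y (gen u * q) = 0" for q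
    using gen_square_odd[OF u(1)] by simp
  then have "gen u * contract_along \<theta> Y (gen u * - contract_along \<theta> Y p) = 0" .
  then show ?thesis
    by (simp only: shear_def neg contract_along_add distrib_left) simp
qed

end

text \<open>
  If \<open>\<theta> u \<noteq> 0\<close>, rescale to \<open>\<psi> = \<theta> / \<theta> u\<close>, so that the vanishing hypothesis says \<open>\<partial>\<^sub>u = - \<partial>\<^sub>\<psi>\<close> on \<open>d V\<close>,
  with \<open>\<psi>\<close> now supported away from \<open>u\<close>.  The shear \<open>p \<mapsto> p + u * \<partial>\<^sub>\<psi> p\<close> then acts on \<open>d V\<close> as
  \<open>p \<mapsto> p - u * \<partial>\<^sub>u p\<close>, that is, it deletes all monomials containing \<open>u\<close>.  In the differential conjugated by this shear,
  \<open>u\<close> is closed and does not occur in any differential, so it may join the second stage, and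
  \<open>V\<close> was not of maximal dimension.
\<close>
lemma maximal_stage_detects_functionals:
  assumes ts: "two_stage U V d" and max: "displays_max_dim U V d"
    and fin: "finite U" "finite V" and odd: "\<forall>x\<in>U \<union> V. odd (gdeg x)"
    and Y: "Y \<subseteq> U" "\<forall>y\<in>Y. gdeg y = k"
    and vanish: "\<forall>v\<in>V. contract_along \<theta> Y (d (gen v)) = 0"
  shows "\<forall>u\<in>Y. \<theta> u = 0"
proof (rule ccontr)
  assume "\<not> ?thesis"
  then obtain u where u: "u \<in> Y" "\<theta> u \<noteq> 0" by auto
  define W where "W = U \<union> V"
  \<comment> \<open>With \<open>u\<close> included the shear would send \<open>u\<close> to \<open>2 u\<close>, and the opposite shear would send \<open>u\<close> to 0.\<close>
  define Z where "Z = Y - {u}"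
  define \<psi> where "\<psi> y = \<theta> y / \<theta> u" for y
  define \<phi> where "\<phi> = shear u \<psi> Z"
  define \<phi>' where "\<phi>' = shear u (\<lambda>y. - \<psi> y) Z"
  define d' where "d' x = \<phi> (d (\<phi>' x))" for x
  have uW: "u \<in> W" "u \<in> U" "odd (gdeg u)" "u \<notin> Z" using u Y odd by (auto simp: W_def Z_def)
  have Z: "finite Z" "\<forall>y\<in>Z. odd (gdeg y)" "\<forall>y\<in>Z. gdeg y = gdeg u"
    using Y u(1) uW(3) fin finite_subset by (auto simp: Z_def)
  have inv: "\<phi> (\<phi>' x) = x" "\<phi>' (\<phi> x) = x" for x
    using shear_inverse[OF uW(3,4) Z(1,2), of \<psi> x] shear_inverse[OF uW(3,4) Z(1,2), of "\<lambda>y. - \<psi> y" x]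
    by (simp_all add: \<phi>_def \<phi>'_def)
  have mult: "\<phi> (x * y) = \<phi> x * \<phi> y" "\<phi>' (x * y) = \<phi>' x * \<phi>' y" for x y
    unfolding \<phi>_def \<phi>'_def by (rule shear_mult[OF uW(3,4) Z(1,2)])+
  have lin: "\<phi> (x + y) = \<phi> x + \<phi> y" "\<phi>' (x + y) = \<phi>' x + \<phi>' y"
    "\<phi> (qscale c x) = qscale c (\<phi> x)" "\<phi>' (qscale c x) = qscale c (\<phi>' x)" "\<phi> 0 = 0" for x y c
    by (simp_all add: \<phi>_def \<phi>'_def shear_add shear_qscale shear_zero)
  have \<Lambda>: "\<phi> x \<in> \<Lambda> W" "\<phi>' x \<in> \<Lambda> W" if "x \<in> \<Lambda> W" for x
    using that uW(1) by (simp_all add: \<phi>_def \<phi>'_def shear_in_Lambda)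
  have hom: "\<phi> x \<in> homogeneous j" "\<phi>' x \<in> homogeneous j" if "x \<in> homogeneous j" for x j
    using that Z(3) by (simp_all add: \<phi>_def \<phi>'_def shear_homogeneous)
  have mm: "minimal_model W d" and disj: "U \<inter> V = {}"
    and dU: "\<And>x. x \<in> lin U \<Longrightarrow> d x = 0" and dV: "\<And>x. x \<in> lin V \<Longrightarrow> d x \<in> \<Lambda> U"
    using ts by (auto simp: two_stage_def W_def)
  then have d: "differential W d" by (simp add: minimal_model_def)
  note D = differential_in_Lambda[OF d] differential_add[OF d] differential_qscale[OF d]
    differential_homogeneous[OF d] differential_times[OF d] differential_square[OF d]
  have d': "differential W d'"
    unfolding differential_def
  proof (intro conjI ballI allI)
    fix i x y assume "x \<in> \<Lambda> W \<inter> homogeneous i" "y \<in> \<Lambda> W"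
    then show "d' (x * y) = d' x * y + (-1) ^ i * x * d' y"
      using hom(2)[of x i]
      by (simp add: d'_def mult lin \<Lambda> D(5)[where k = i] inv qscale_mult_left minus_one_power_mult)
  qed (use hom(2) in \<open>auto simp: d'_def lin \<Lambda> D inv intro!: hom D(4)[simplified]\<close>)
  have removed: "\<phi> (d (gen v)) = d (gen v) - gen u * contract u (d (gen v))" if "v \<in> V" for v
  proof -
    let ?p = "d (gen v)"
    have "(\<Sum>y\<in>Y. qscale (\<theta> y) (contract y ?p)) = 0"
      using vanish that by (simp add: contract_along_def)
    then have "qscale (\<theta> u) (contract u ?p) + (\<Sum>y\<in>Z. qscale (\<theta> y) (contract y ?p)) = 0"
      using u(1) Y(1) fin(1) finite_subset[of Y U] by (simp add: Z_def sum.remove)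
    then have "qscale (1 / \<theta> u) (qscale (\<theta> u) (contract u ?p) + (\<Sum>y\<in>Z. qscale (\<theta> y) (contract y ?p))) = 0"
      by simp
    then have "contract u ?p + contract_along \<psi> Z ?p = 0"
      using u(2) by (simp add: contract_along_def \<psi>_def Q.scale_right_distrib Q.scale_sum_right)
    then have "contract_along \<psi> Z ?p = - contract u ?p" by (simp add: add_eq_0_iff)
    then show ?thesis by (simp add: \<phi>_def shear_def)
  qed
  have coeff_removed: "coeff (\<phi> (d (gen v))) m = (if u \<in># m then 0 else coeff (d (gen v)) m)"
    if "v \<in> V" for v m
    using removed[OF that] by (simp add: coeff_gen_contract)
  have gen': "x \<notin> U \<Longrightarrow> \<phi>' (gen x) = gen x" "x \<in> U \<Longrightarrow> \<phi>' (gen x) \<in> lin U" for x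
    using Y(1) uW(2) unfolding \<phi>'_def shear_gen[OF uW(3,4) Z(1,2)]
    by (auto simp: Z_def lin_def intro!: Q.span_add Q.span_diff Q.span_scale intro: gen_in_lin[unfolded lin_def])
  have d'U: "d' (gen x) = 0" if "x \<in> U" for x
    unfolding d'_def using gen'(2)[OF that] dU lin(5) by simp
  have d'V: "d' (gen v) = \<phi> (d (gen v))" if "v \<in> V" for v
    unfolding d'_def by (subst gen'(1)) (use that disj in auto)
  have d'_span: "d' x \<in> S" if x: "x \<in> lin X" and X: "X \<subseteq> W" and S: "Q.subspace S"
    and g: "\<And>y. y \<in> X \<Longrightarrow> d' (gen y) \<in> S" for X S x
  proof -
    have "lin X \<subseteq> {x \<in> \<Lambda> W. d' x \<in> S}"
      unfolding lin_def
    proof (rule Q.span_minimal)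
      show "Q.subspace {x \<in> \<Lambda> W. d' x \<in> S}"
        using S subspace_Lambda[of W] differential_add[OF d'] differential_qscale[OF d']
          differential_qscale[OF d', of 0 0]
        by (auto simp: Q.subspace_def)
    qed (use g X in \<open>auto intro: gen_in_Lambda\<close>)
    then show ?thesis using x by auto
  qed
  \<comment> \<open>The conjugated differential is a two-stage model with one more generator in the second stage.\<close>
  let ?U = "U - {u}" and ?V = "insert u V"
  have W': "?U \<union> ?V = W" using uW by (auto simp: W_def)
  have "minimal_model W d'"
    unfolding minimal_model_def
  proof (intro conjI ballI allI)
    fix w x assume "w \<in> lin W"
    then have "d' w \<in> {p. coeff p {#x#} = 0}"
    proof (rule d'_span)
      fix y assume "y \<in> W"
      then consider "y \<in> U" | "y \<in> V" by (auto simp: W_def)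
      then show "d' (gen y) \<in> {p. coeff p {#x#} = 0}"
      proof cases
        case 2
        then have "coeff (d (gen y)) {#x#} = 0"
          using mm gen_in_lin[of y W] \<open>y \<in> W\<close> by (auto simp: minimal_model_def)
        then show ?thesis using 2 by (simp add: d'V coeff_removed)
      qed (simp add: d'U)
    qed (auto simp: Q.subspace_def)
    then show "coeff (d' w) {#x#} = 0" by simp
  qed (use d' mm in \<open>auto simp: minimal_model_def\<close>)
  moreover have "d' x = 0" if "x \<in> lin ?U" for x
    using d'_span[OF that _ Q.subspace_single_0] d'U by (auto simp: W_def)
  moreover have "d' x \<in> \<Lambda> ?U" if "x \<in> lin ?V" for x
  proof (rule d'_span[OF that _ subspace_Lambda])
    fix y assume y: "y \<in> ?V"
    show "d' (gen y) \<in> \<Lambda> ?U"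
    proof (cases "y = u")
      case False
      then have "y \<in> V" using y by simp
      then have "d (gen y) \<in> \<Lambda> U" using dV gen_in_lin by blast
      then show ?thesis
        using \<open>y \<in> V\<close> by (auto simp: d'V mem_Lambda_iff coeff_removed split: if_splits)
    qed (use d'U uW Q.subspace_0[OF subspace_Lambda] in auto)
  qed (use uW in \<open>auto simp: W_def\<close>)
  ultimately have "two_stage ?U ?V d'"
    unfolding two_stage_def W' using disj by auto
  moreover have "dga_iso (U \<union> V) d (?U \<union> ?V) d' \<phi>"
    unfolding dga_iso_def W' W_def[symmetric]
    using \<Lambda> inv lin mult hom shear_one[of u \<psi> Z]
    by (auto simp: d'_def \<phi>_def[symmetric] intro!: bij_betw_byWitness[where f' = \<phi>'])
  ultimately have "card ?V \<le> card V" using max unfolding displays_max_dim_def by blast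
  then show False using fin(2) disj uW(2) by (auto simp: card_insert_if disjoint_iff)
qed

section \<open>Toral extensions vanish on the first stage\<close>

text \<open>
  \<open>D\<close> and \<open>d\<close> agree modulo the ideal generated by \<open>A\<close>, and every monomial in that ideal contains an
  element of \<open>A\<close>.
\<close>
lemma extension_coeff:
  assumes "ks_extension A W d D" "x \<in> \<Lambda> W" "set_mset m \<inter> A = {}"
  shows "coeff (D x) m = coeff (d x) m"
proof -
  have "ideal_in (\<Lambda> (A \<union> W)) (gen ` A) \<subseteq> {p. coeff p m = 0}"
    unfolding ideal_in_def
  proof (rule Q.span_minimal)
    show "Q.subspace {p. coeff p m = 0}" by (auto simp: Q.subspace_def)
    show "{x * a * y |x a y. x \<in> \<Lambda> (A \<union> W) \<and> a \<in> gen ` A \<and> y \<in> \<Lambda> (A \<union> W)} \<subseteq> {p. coeff p m = 0}"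
    proof clarify
      fix x a y assume a: "a \<in> A"
      show "coeff (x * gen a * y) m = 0"
      proof (rule ccontr)
        assume "coeff (x * gen a * y) m \<noteq> 0"
        then obtain n n' where n: "m = n + n'" "coeff (x * gen a) n \<noteq> 0" by (rule coeff_times_nonzero)
        from n(2) obtain l l' where "n = l + l'" "coeff (gen a) l' \<noteq> 0" by (rule coeff_times_nonzero)
        then have "a \<in># m" using n(1) by (auto simp: gen_eq_monom coeff_monom split: if_splits)
        then show False using a assms(3) by auto
      qed
    qed
  qed
  then have "coeff (D x - d x) m = 0" using assms(1,2) by (auto simp: ks_extension_def)
  then show ?thesis by simp
qed

lemma mdeg_odd_part:
  assumes "odd (mdeg m)" obtains x n where "m = add_mset x n" "odd (gdeg x)"
proof -
  have "\<exists>x\<in>#m. odd (gdeg x)" using assms by (induction m) auto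
  then show ?thesis using that by (auto dest: multi_member_split)
qed

text \<open>
  By parity a second odd factor must accompany \<open>w\<close>, and it cannot come from \<open>A\<close>.
\<close>
lemma mixed_monomial_degree:
  assumes "even (mdeg m)" "set_mset m \<subseteq> A \<union> W" "\<forall>a\<in>A. gdeg a = 2"
    and "a \<in> A" "a \<in># m" "w \<in># m" "odd (gdeg w)"
  obtains w' where "w' \<in> W" "gdeg w + gdeg w' + 2 \<le> mdeg m"
proof -
  have "a \<noteq> w" using assms by auto
  then obtain n where m: "m = add_mset a (add_mset w n)"
    using assms(5,6) by (metis insert_noteq_member multi_member_split)
  have "odd (mdeg n)" using assms by (simp add: m)
  then obtain x n' where "n = add_mset x n'" "odd (gdeg x)" by (rule mdeg_odd_part)
  then show ?thesis using that[of x] assms by (auto simp: m)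
qed

lemma even_homogeneous_commute:
  "x \<in> homogeneous j \<Longrightarrow> y \<in> homogeneous k \<Longrightarrow> even j \<Longrightarrow> x * y = y * x"
  using graded_commutative[of x j y k] by (simp add: minus_one_power_iff)

text \<open>
  Both sides are derivations with the same values on generators.  The right side satisfies the
  derivation rule because each \<open>D u\<close> has even degree and therefore commutes with everything.
\<close>
lemma differential_eq_contractions:
  assumes D: "differential X D" and "A \<union> U \<subseteq> X" "finite U" "\<forall>u\<in>U. odd (gdeg u)"
    and "\<forall>a\<in>A. D (gen a) = 0" and x: "x \<in> \<Lambda> (A \<union> U)"
  shows "D x = (\<Sum>u\<in>U. D (gen u) * contract u x)"
  using x
proof (induction rule: Lambda_induct)
  case one
  show ?case by (simp add: differential_one[OF D] contract_one)
next
  case (gen y p)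
  have sub: "\<Lambda> (A \<union> U) \<subseteq> \<Lambda> X" using assms(2) by (rule Lambda_mono)
  have p: "p \<in> \<Lambda> X" "gen y \<in> \<Lambda> X" using gen sub assms(2) by (auto intro: gen_in_Lambda)
  have Du: "D (gen u) \<in> homogeneous (gdeg u + 1)" if "u \<in> U" for u
    using that assms(2) by (intro differential_homogeneous[OF D] gen_homogeneous gen_in_Lambda) auto
  have "(\<Sum>u\<in>U. D (gen u) * contract u (gen y * p))
    = (\<Sum>u\<in>U. (if u = y then D (gen u) * p else 0)
        + qscale ((-1) ^ gdeg y) (gen y * (D (gen u) * contract u p)))"
  proof (intro sum.cong refl)
    fix u assume u: "u \<in> U"
    have "D (gen u) * gen y = gen y * D (gen u)"
      using even_homogeneous_commute[OF Du[OF u] gen_homogeneous] assms(4) u by simp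
    then have "D (gen u) * (gen y * contract u p) = gen y * (D (gen u) * contract u p)"
      by (simp flip: mult.assoc)
    then show "D (gen u) * contract u (gen y * p) = (if u = y then D (gen u) * p else 0)
        + qscale ((-1) ^ gdeg y) (gen y * (D (gen u) * contract u p))"
      using u assms(4) by (simp add: contract_gen_times distrib_left qscale_mult_right)
  qed
  also have "\<dots> = D (gen y) * p + qscale ((-1) ^ gdeg y) (gen y * D p)"
    using gen assms(3,5) by (auto simp: sum.distrib Q.scale_sum_right sum_distrib_left)
  also have "\<dots> = D (gen y * p)"
    using p by (intro differential_times[OF D, symmetric] gen_homogeneous)
  finally show ?case by simp
next
  case (add p q)
  then have "D (p + q) = D p + D q"
    using Lambda_mono[OF assms(2)] by (intro differential_add[OF D]) auto
  then show ?case using add by (simp add: contract_add distrib_left sum.distrib)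
next
  case (scale c p)
  then have "D (qscale c p) = qscale c (D p)"
    using Lambda_mono[OF assms(2)] by (intro differential_qscale[OF D]) auto
  then show ?case using scale by (simp add: contract_qscale qscale_mult_right Q.scale_sum_right)
qed

text \<open>
  All monomials of \<open>p\<close> have degree \<open>j\<close>, which is at least the degree of the \<open>A\<close>-part \<open>a\<close> of the target
  monomial.  So \<open>p\<close> has to supply all of \<open>a\<close>, and \<open>q\<close> supplies the rest.
\<close>
lemma coeff_times_lowest:
  assumes A: "\<forall>a\<in>A. gdeg a = 2" and p: "p \<in> \<Lambda> A" "p \<in> homogeneous j"
    and a: "set_mset a \<subseteq> A" "mdeg a \<le> j" and m: "set_mset m \<inter> A = {}"
  shows "coeff (p * q) (a + m) = coeff p a * coeff q m"
proof -
  have only: "b = a" if "coeff p b \<noteq> 0" "b \<subseteq># a + m" for b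
  proof -
    have "set_mset b \<subseteq> A" using p(1) that(1) by (simp add: mem_Lambda_iff)
    then have "count m x = 0 \<or> count b x = 0" for x
      using m by (auto simp: count_eq_zero_iff)
    then have "count b x \<le> count a x" for x
      using mset_subset_eq_count[OF that(2), of x] by (metis add_0_right count_union zero_le)
    then have "b \<subseteq># a" by (rule mset_subset_eqI)
    then obtain c where c: "a = b + c" by (auto simp: mset_subset_eq_exists_conv)
    then have "mdeg c = 0" using homogeneousD[OF p(2) that(1)] a(2) by simp
    then have "c = {#}" using c a(1) A by (cases c) auto
    then show ?thesis using c by simp
  qed
  have "coeff (p * q) (a + m) = (\<Sum>b\<in>{a}. coeff p b * koszul b (a + m - b) * coeff q (a + m - b))"
    unfolding coeff_times by (rule sum.mono_neutral_left) (use only in auto)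
  also have "\<dots> = coeff p a * (koszul a m * coeff q m)" by simp
  also have "koszul a m * coeff q m = coeff q m"
  proof (cases "coeff q m = 0")
    case False
    have even: "even (gdeg x)" if "x \<in># a" for x using that a(1) A by auto
    then have "count a x = 0" if "odd (gdeg x)" for x
      using that by (meson not_in_iff)
    then have "admissible (a + m)"
      using coeff_admissible[OF False] by (simp add: admissible_def)
    moreover have "inversions a m = 0" using even by (simp add: inversions_def)
    ultimately show ?thesis by (simp add: koszul_def)
  qed simp
  finally show ?thesis .
qed

text \<open>
  Strong induction on the degree \<open>k\<close> of \<open>u\<close>.  For a monomial \<open>a\<close> in \<open>A\<close> of degree \<open>k + 1\<close> and a monomial \<open>m\<close> in \<open>U\<close>,
  the coefficient of \<open>a + m\<close> in \<open>0 = D (D v) = \<Sum>u\<in>U. D u * \<partial>\<^sub>u (D v)\<close> receives nothing from \<open>|u| < k\<close> by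
  induction and nothing from \<open>|u| > k\<close>, since then the degree of \<open>D u\<close> exceeds that of \<open>a\<close>.  What remains is the
  coefficient of \<open>m\<close> in the contraction of \<open>d v\<close> along \<open>u \<mapsto> coeff (D u) a\<close>.
\<close>
lemma base_differential_vanishes:
  assumes ts: "two_stage U V d" and max: "displays_max_dim U V d"
    and fin: "finite U" "finite V" and odd: "\<forall>x\<in>U \<union> V. odd (gdeg x)"
    and ext: "ks_extension A (U \<union> V) d D" and A: "\<forall>a\<in>A. gdeg a = 2"
    and DU: "\<forall>u\<in>U. D (gen u) \<in> \<Lambda> A" and DV: "\<forall>v\<in>V. D (gen v) \<in> \<Lambda> (A \<union> U)"
  shows "\<forall>u\<in>U. D (gen u) = 0"
proof -
  have D: "differential (A \<union> (U \<union> V)) D" and DA: "\<forall>a\<in>A. D (gen a) = 0" and disj: "A \<inter> (U \<union> V) = {}"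
    using ext by (auto simp: ks_extension_def)
  have hom: "D (gen u) \<in> homogeneous (gdeg u + 1)" if "u \<in> U" for u
    using that by (intro differential_homogeneous[OF D] gen_homogeneous gen_in_Lambda) auto
  have "\<forall>u\<in>U. gdeg u = k \<longrightarrow> D (gen u) = 0" for k
  proof (induction k rule: less_induct)
    case (less k)
    define Y where "Y = {u \<in> U. gdeg u = k}"
    have "\<forall>y\<in>Y. coeff (D (gen y)) a = 0" for a
    proof (cases "set_mset a \<subseteq> A \<and> mdeg a = k + 1")
      case False
      show ?thesis
      proof (rule ccontr)
        assume "\<not> ?thesis"
        then obtain y where "y \<in> U" "gdeg y = k" "coeff (D (gen y)) a \<noteq> 0" by (auto simp: Y_def)
        then have "set_mset a \<subseteq> A" "mdeg a = k + 1"
          using DU homogeneousD[OF hom] by (auto simp: mem_Lambda_iff)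
        then show False using False by simp
      qed
    next
      case a: True
      show ?thesis
      proof (rule maximal_stage_detects_functionals[OF ts max fin odd, of Y k])
        show "\<forall>v\<in>V. contract_along (\<lambda>y. coeff (D (gen y)) a) Y (d (gen v)) = 0"
        proof (intro ballI gca_eqI)
          fix v m assume v: "v \<in> V"
          have dv: "d (gen v) \<in> \<Lambda> U"
            using ts v by (simp add: two_stage_def gen_in_lin)
          show "coeff (contract_along (\<lambda>y. coeff (D (gen y)) a) Y (d (gen v))) m = coeff 0 m"
          proof (cases "set_mset m \<subseteq> U")
            case False
            then show ?thesis
              using contract_along_in_Lambda[OF dv] by (force simp: mem_Lambda_iff)
          next
            case True
            then have m: "set_mset m \<inter> A = {}" using disj by auto
            have summand: "coeff (D (gen y) * contract y (D (gen v))) (a + m)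
                = (if gdeg y = k then coeff (D (gen y)) a * coeff (contract y (d (gen v))) m else 0)"
              if y: "y \<in> U" for y
            proof (cases "gdeg y < k")
              case lt: True
              then have "D (gen y) = 0" using less.IH y by blast
              then show ?thesis using lt by simp
            next
              case False
              then have "coeff (D (gen y) * contract y (D (gen v))) (a + m)
                = coeff (D (gen y)) a * coeff (contract y (D (gen v))) m"
                using a DU y hom[OF y] m by (intro coeff_times_lowest[OF A]) auto
              moreover have "coeff (D (gen y)) a = 0" if "gdeg y \<noteq> k"
                using that homogeneousD[OF hom[OF y], of a] a by auto
              moreover have "coeff (D (gen v)) (add_mset y m) = coeff (d (gen v)) (add_mset y m)"
                using m y disj v by (intro extension_coeff[OF ext] gen_in_Lambda) auto
              ultimately show ?thesis by (simp add: coeff_contract)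
            qed
            have "0 = D (D (gen v))"
              using v by (intro differential_square[OF D, symmetric] gen_in_Lambda) auto
            also have "\<dots> = (\<Sum>y\<in>U. D (gen y) * contract y (D (gen v)))"
              using DV v odd disj DA fin by (intro differential_eq_contractions[OF D, where A = A]) auto
            finally have "0 = coeff \<dots> (a + m)" by simp
            also have "\<dots> = (\<Sum>y\<in>U. if gdeg y = k
                then coeff (D (gen y)) a * coeff (contract y (d (gen v))) m else 0)"
              unfolding coeff_sum by (intro sum.cong refl summand)
            also have "\<dots> = coeff (contract_along (\<lambda>y. coeff (D (gen y)) a) Y (d (gen v))) m"
              using fin(1) by (simp add: contract_along_def coeff_sum Y_def flip: sum.inter_filter)
            finally show ?thesis by simp
          qed
        qed
      qed (auto simp: Y_def)
    qed
    then show ?case by (auto simp: Y_def intro: gca_eqI)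
  qed
  then show ?thesis by blast
qed

section \<open>Polynomial rings finite over a subring\<close>

text \<open>
  Multisets under addition are the monomials of a polynomial ring, so finitely supported functions on
  them form the commutative polynomial ring over \<open>\<rat>\<close>, with one variable for each element of \<open>'x\<close>.
\<close>
global_interpretation P: vector_space "\<lambda>(c::rat) (p :: 'x multiset \<Rightarrow>\<^sub>0 rat). Poly_Mapping.single 0 c * p"
  by unfold_locales (simp_all add: algebra_simps single_add mult_single flip: mult.assoc)

lemma (in vector_space) span_image_linear:
  assumes "x \<in> span S" "\<And>x y. g (x + y) = g x + g y" "\<And>c x. g (scale c x) = scale c (g x)"
    "\<And>x. x \<in> S \<Longrightarrow> g x \<in> span T"
  shows "g x \<in> span T"
proof -
  have "span S \<subseteq> {x. g x \<in> span T}"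
  proof (rule span_minimal)
    show "subspace {x. g x \<in> span T}"
      using assms(3)[of 0 0] by (auto simp: subspace_def assms(2,3) span_zero intro: span_add span_scale)
  qed (use assms in auto)
  then show ?thesis using assms(1) by auto
qed

definition bounded_monomials :: "'x set \<Rightarrow> nat \<Rightarrow> 'x multiset set" where
  "bounded_monomials X K = {m. set_mset m \<subseteq> X \<and> (\<forall>x. count m x \<le> K)}"

lemma card_bounded_monomials:
  assumes "finite X"
  shows "finite (bounded_monomials X K)" "card (bounded_monomials X K) = (K + 1) ^ card X"
proof -
  have "bij_betw (\<lambda>e. Abs_multiset (\<lambda>x. if x \<in> X then e x else 0)) (X \<rightarrow>\<^sub>E {..K}) (bounded_monomials X K)"
  proof (rule bij_betw_byWitness[where f' = "\<lambda>m. restrict (count m) X"])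
    have [simp]: "count (Abs_multiset (\<lambda>x. if x \<in> X then e x else 0)) = (\<lambda>x. if x \<in> X then e x else 0)"
      for e :: "'a \<Rightarrow> nat"
      by (rule count_Abs_multiset) (use assms in simp)
    show "\<forall>e\<in>X \<rightarrow>\<^sub>E {..K}. restrict (count (Abs_multiset (\<lambda>x. if x \<in> X then e x else 0))) X = e"
      by (auto simp: fun_eq_iff restrict_def PiE_def extensional_def)
    show "\<forall>m\<in>bounded_monomials X K. Abs_multiset (\<lambda>x. if x \<in> X then restrict (count m) X x else 0) = m"
      by (auto simp: bounded_monomials_def multiset_eq_iff count_eq_zero_iff)
    have "x \<in> X" if "x \<in># Abs_multiset (\<lambda>x. if x \<in> X then e x else 0)" for e x
      using that unfolding count_greater_zero_iff[symmetric] by (auto split: if_splits)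
    then show "(\<lambda>e. Abs_multiset (\<lambda>x. if x \<in> X then e x else 0)) ` (X \<rightarrow>\<^sub>E {..K}) \<subseteq> bounded_monomials X K"
      by (auto simp: bounded_monomials_def)
    show "(\<lambda>m. restrict (count m) X) ` bounded_monomials X K \<subseteq> X \<rightarrow>\<^sub>E {..K}"
      by (auto simp: bounded_monomials_def)
  qed
  with assms show "finite (bounded_monomials X K)" "card (bounded_monomials X K) = (K + 1) ^ card X"
    by (auto dest: bij_betw_finite bij_betw_same_card simp: card_PiE finite_PiE)
qed

lemma size_le_bounded_monomials:
  assumes "finite X" "m \<in> bounded_monomials X K"
  shows "size m \<le> card X * K"
proof -
  have "size m = sum (count m) (set_mset m)" by (simp add: size_multiset_overloaded_eq)
  also have "\<dots> \<le> sum (count m) X"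
    using assms by (intro sum_mono2) (auto simp: bounded_monomials_def)
  also have "\<dots> \<le> card X * K"
    using assms sum_bounded_above[of X "count m" K] by (simp add: bounded_monomials_def)
  finally show ?thesis .
qed

lemma in_bounded_monomials_size: "set_mset m \<subseteq> X \<Longrightarrow> size m \<le> K \<Longrightarrow> m \<in> bounded_monomials X K"
  by (auto simp: bounded_monomials_def intro: order_trans[OF count_le_size])


lemma inj_single_one: "inj_on (\<lambda>m. Poly_Mapping.single m (1::rat)) M"
  by (rule inj_onI) (metis lookup_single_eq lookup_single_not_eq zero_neq_one)


lemma monomials_independent:
  assumes "finite M"
  shows "P.independent ((\<lambda>m. Poly_Mapping.single m (1::rat)) ` M)"
proof (rule P.independent_if_scalars_zero)
  fix c :: "('a multiset \<Rightarrow>\<^sub>0 rat) \<Rightarrow> rat" and p :: "'a multiset \<Rightarrow>\<^sub>0 rat"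
  assume "(\<Sum>p\<in>(\<lambda>m. Poly_Mapping.single m 1) ` M. Poly_Mapping.single 0 (c p) * p) = 0"
  then have *: "(\<Sum>m\<in>M. Poly_Mapping.single m (c (Poly_Mapping.single m 1))) = 0"
    by (simp add: sum.reindex inj_single_one mult_single)
  assume "p \<in> (\<lambda>m. Poly_Mapping.single m 1) ` M"
  then obtain m where m: "m \<in> M" "p = Poly_Mapping.single m 1" by auto
  then show "c p = 0"
    using arg_cong[OF *, of "\<lambda>q. Poly_Mapping.lookup q m"] assms
    by (simp add: lookup_sum lookup_single when_def)
qed (use assms in simp)

text \<open>
  The inequality between the number of variables and the number of generators of an ideal with
  finite-dimensional quotient, by counting dimensions.  Applying the hypothesis repeatedly expresses
  every monomial of size at most \<open>k\<close> through products of a monomial of size at most \<open>N\<close> and powers of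
  the \<open>f v\<close> with exponents at most \<open>k\<close>.
  In \<open>n = card X\<close> variables there are \<open>(K + 1)\<^sup>n\<close> monomials with exponents at most \<open>K\<close>.  They have size at most \<open>n K\<close>,
  so they lie in the span of \<open>O((K + 1)\<^sup>m)\<close> products, where \<open>m = card V\<close>.  This forces
  \<open>n \<le> m\<close>.
\<close>
lemma variables_le_generators:
  fixes f :: "'v \<Rightarrow> ('x multiset \<Rightarrow>\<^sub>0 rat)"
  assumes "finite X" "finite V"
    and reduce: "\<And>m. set_mset m \<subseteq> X \<Longrightarrow> size m > N \<Longrightarrow> Poly_Mapping.single m 1 \<in>
        P.span {Poly_Mapping.single b 1 * f v | b v. set_mset b \<subseteq> X \<and> size b < size m \<and> v \<in> V}"
  shows "card X \<le> card V"
proof -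
  define g where "g = (\<lambda>(b, e). Poly_Mapping.single b 1 * (\<Prod>v\<in>V. f v ^ e v))"
  define G where "G k = g ` (bounded_monomials X N \<times> (V \<rightarrow>\<^sub>E {..k}))" for k
  have spanned: "Poly_Mapping.single m 1 \<in> P.span (G k)" if "set_mset m \<subseteq> X" "size m \<le> k" for m k
    using that
  proof (induction "size m" arbitrary: m k rule: less_induct)
    case less
    show ?case
    proof (cases "size m \<le> N")
      case True
      then have "Poly_Mapping.single m 1 = g (m, \<lambda>v\<in>V. 0)"
        by (simp add: g_def)
      also have "\<dots> \<in> G k"
        unfolding G_def using True less.prems
        by (intro imageI) (auto intro: in_bounded_monomials_size)
      finally show ?thesis by (rule P.span_base)
    next
      case False
      have "Poly_Mapping.single b 1 * f v \<in> P.span (G k)"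
        if b: "set_mset b \<subseteq> X" "size b < size m" and v: "v \<in> V" for b v
      proof -
        have k: "size b \<le> k - 1" "k > 0" using b less.prems by auto
        have "Poly_Mapping.single b 1 \<in> P.span (G (k - 1))"
          using less.hyps[of b "k - 1"] b k by blast
        then show ?thesis
        proof (rule P.span_image_linear[where g = "\<lambda>p. p * f v"])
          fix x assume "x \<in> G (k - 1)"
          then obtain c e where c: "c \<in> bounded_monomials X N" and e: "e \<in> V \<rightarrow>\<^sub>E {..k - 1}"
            and x: "x = g (c, e)" by (auto simp: G_def)
          \<comment> \<open>Multiplication by \<open>f v\<close> raises one exponent by 1; the drop in size of the monomial pays for it.\<close>
          have "(\<Prod>w\<in>V. f w ^ (e(v := e v + 1)) w) = f v ^ (e v + 1) * (\<Prod>w\<in>V - {v}. f w ^ e w)"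
            using assms(2) v by (simp add: prod.remove)
          also have "\<dots> = (\<Prod>w\<in>V. f w ^ e w) * f v"
            using assms(2) v by (simp add: prod.remove[of V v "\<lambda>w. f w ^ e w"])
          finally have "x * f v = g (c, e(v := e v + 1))"
            by (simp add: x g_def mult.assoc)
          moreover have "e(v := e v + 1) \<in> V \<rightarrow>\<^sub>E {..k}"
            using e v k by (force simp: PiE_def extensional_def Pi_def)
          ultimately have "x * f v \<in> G k" using c unfolding G_def by blast
          then show "x * f v \<in> P.span (G k)" by (rule P.span_base)
        qed (simp_all add: algebra_simps)
      qed
      then have "P.span {Poly_Mapping.single b 1 * f v | b v. set_mset b \<subseteq> X \<and> size b < size m \<and> v \<in> V}
          \<subseteq> P.span (G k)"
        by (intro P.span_minimal P.subspace_span) auto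
      then show ?thesis using reduce[of m] False less.prems by auto
    qed
  qed
  \<comment> \<open>The bound \<open>n K + 1 \<le> (n + 1) (K + 1)\<close> separates the dependence on \<open>K\<close> from the constant \<open>C\<close>.\<close>
  define C where "C = (N + 1) ^ card X * (card X + 1) ^ card V"
  have count: "(K + 1) ^ card X \<le> C * (K + 1) ^ card V" for K
  proof -
    let ?k = "card X * K"
    let ?M = "(\<lambda>m. Poly_Mapping.single m (1::rat)) ` bounded_monomials X K"
    have fin: "finite (bounded_monomials X N \<times> (V \<rightarrow>\<^sub>E {..?k}))"
      using assms by (simp add: card_bounded_monomials finite_PiE)
    have "?M \<subseteq> P.span (G ?k)"
      using size_le_bounded_monomials[OF assms(1)] spanned by (auto simp: bounded_monomials_def)
    moreover have "P.independent ?M"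
      using card_bounded_monomials(1)[OF assms(1)] by (rule monomials_independent)
    moreover have "finite (G ?k)" unfolding G_def using fin by blast
    ultimately have "card ?M \<le> card (G ?k)"
      using P.independent_span_bound by blast
    also have "\<dots> \<le> card (bounded_monomials X N \<times> (V \<rightarrow>\<^sub>E {..?k}))"
      unfolding G_def by (rule card_image_le[OF fin])
    also have "\<dots> = (N + 1) ^ card X * (?k + 1) ^ card V"
      using assms by (simp add: card_cartesian_product card_bounded_monomials card_PiE)
    also have "\<dots> \<le> (N + 1) ^ card X * ((card X + 1) * (K + 1)) ^ card V"
      by (intro mult_le_mono2 power_mono) auto
    also have "\<dots> = C * (K + 1) ^ card V" by (simp only: C_def power_mult_distrib mult.assoc)
    finally show ?thesis
      using assms(1) by (simp add: card_image inj_single_one card_bounded_monomials)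
  qed
  show ?thesis
  proof (rule ccontr)
    assume "\<not> card X \<le> card V"
    then obtain j where j: "card X = card V + Suc j" by (metis less_imp_Suc_add not_le add_Suc_right)
    \<comment> \<open>For \<open>n > m\<close> the count already fails at \<open>K = C\<close>.\<close>
    have "C + 1 \<le> (C + 1) ^ Suc j" by (rule self_le_power) auto
    moreover have "(C + 1) ^ card V * (C + 1) ^ Suc j \<le> (C + 1) ^ card V * C"
      using count[of C] unfolding j power_add by (simp add: mult.commute)
    then have "(C + 1) ^ Suc j \<le> C" by (metis mult_le_cancel1 zero_less_power add_gr_0 zero_less_one)
    ultimately show False by simp
  qed
qed

section \<open>Finite cohomology bounds the number of base variables\<close>

text \<open>
  The algebra map to the polynomial ring that sends all generators outside \<open>A\<close> to zero; it is multiplicative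
  if \<open>A\<close> consists of even generators.
\<close>
definition restrict_to :: "gen set \<Rightarrow> gca \<Rightarrow> (gen multiset \<Rightarrow>\<^sub>0 rat)" where
  "restrict_to A p = (\<Sum>m | coeff p m \<noteq> 0 \<and> set_mset m \<subseteq> A. Poly_Mapping.single m (coeff p m))"

lemma lookup_restrict_to:
  "Poly_Mapping.lookup (restrict_to A p) m = (if set_mset m \<subseteq> A then coeff p m else 0)"
proof -
  have "finite {m. coeff p m \<noteq> 0 \<and> set_mset m \<subseteq> A}"
    by (rule finite_subset[OF _ finite_coeff[of p]]) auto
  then show ?thesis
    by (auto simp: restrict_to_def lookup_sum lookup_single when_def)
qed

lemma lookup_const_times [simp]:
  "Poly_Mapping.lookup (Poly_Mapping.single 0 c * p) m = (c::rat) * Poly_Mapping.lookup p m"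
proof -
  have "Poly_Mapping.single 0 c * p = Poly_Mapping.map ((*) c) p"
    by (induction p rule: poly_mapping_add_induct)
      (simp_all add: map_times_zero map_times_add map_times_single distrib_left mult_single)
  then show ?thesis by (simp add: lookup_map_times)
qed

lemma restrict_to_add: "restrict_to A (p + q) = restrict_to A p + restrict_to A q"
  by (rule poly_mapping_eqI) (simp add: lookup_restrict_to lookup_add)

lemma restrict_to_qscale: "restrict_to A (qscale c p) = Poly_Mapping.single 0 c * restrict_to A p"
  by (rule poly_mapping_eqI) (simp add: lookup_restrict_to)

lemma restrict_to_zero: "restrict_to A 0 = 0"
  by (rule poly_mapping_eqI) (simp add: lookup_restrict_to)

lemma restrict_to_monom:
  "restrict_to A (monom m) = (if admissible m \<and> set_mset m \<subseteq> A then Poly_Mapping.single m 1 else 0)"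
  by (rule poly_mapping_eqI) (auto simp: lookup_restrict_to coeff_monom lookup_single when_def)

lemma restrict_to_times:
  assumes A: "\<forall>a\<in>A. even (gdeg a)"
  shows "restrict_to A (p * q) = restrict_to A p * restrict_to A q"
proof (induction p rule: gca_induct)
  case (monom c m)
  note m = monom
  show ?case
  proof (induction q rule: gca_induct)
    case (monom c' n)
    have "admissible (m + n) \<and> koszul m n = 1" if "set_mset m \<subseteq> A" "set_mset n \<subseteq> A"
    proof -
      have "count (m + n) x = 0" if "odd (gdeg x)" for x
        using that A \<open>set_mset m \<subseteq> A\<close> \<open>set_mset n \<subseteq> A\<close> by (auto simp: count_eq_zero_iff)
      then have "admissible (m + n)" by (simp add: admissible_def)
      moreover have "inversions m n = 0" using that A by (auto simp: inversions_def)
      ultimately show ?thesis by (simp add: koszul_def)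
    qed
    then show ?case
      using m monom
      by (auto simp: qscale_mult_left qscale_mult_right monom_mult restrict_to_qscale restrict_to_monom
          mult_single mult.commute)
  qed (simp_all add: distrib_left restrict_to_add restrict_to_zero)
qed (simp_all add: distrib_right restrict_to_add restrict_to_zero)

lemma mdeg_degree_two: "set_mset m \<subseteq> A \<Longrightarrow> \<forall>a\<in>A. gdeg a = 2 \<Longrightarrow> mdeg m = 2 * size m"
  by (induction m) auto

text \<open>
  In the derivation rule for \<open>D\<close> on a product of generators, the term that differentiates the factor
  \<open>x\<close> vanishes unless \<open>x \<in> V\<close>, and it survives the passage to \<open>\<rat>[A]\<close> only if all other factors lie in \<open>A\<close>.  The
  degree condition records that \<open>D\<close> is homogeneous.
\<close>
lemma base_part_of_boundary:
  assumes D: "differential (A \<union> (U \<union> V)) D" and A: "\<forall>a\<in>A. even (gdeg a)"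
    and DA: "\<forall>a\<in>A. D (gen a) = 0" and DU: "\<forall>u\<in>U. D (gen u) = 0"
    and m: "admissible m" "set_mset m \<subseteq> A \<union> (U \<union> V)"
  shows "restrict_to A (D (monom m)) \<in> P.span {Poly_Mapping.single b 1 * restrict_to A (D (gen v)) | b v.
    set_mset b \<subseteq> A \<and> v \<in> V \<and> mdeg b + gdeg v = mdeg m}" (is "_ \<in> P.span (?S (mdeg m))")
  using m
proof (induction m)
  case empty
  show ?case by (simp add: monom_empty differential_one[OF D] restrict_to_zero P.span_zero)
next
  case (add x m)
  define k where "k = koszul {#x#} m"
  have m: "admissible m" "set_mset m \<subseteq> A \<union> (U \<union> V)" and x: "x \<in> A \<union> (U \<union> V)"
    using add.prems admissible_add[of "{#x#}" m] by auto
  have xm: "gen x \<in> \<Lambda> (A \<union> (U \<union> V))" "monom m \<in> \<Lambda> (A \<union> (U \<union> V))"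
    using m x by (auto intro: gen_in_Lambda monom_in_Lambda)
  have "D (monom (add_mset x m)) = qscale k (D (gen x * monom m))"
    using differential_qscale[OF D mult_in_Lambda[OF xm]] by (simp add: monom_add_mset[OF add.prems(1)] k_def)
  also have "D (gen x * monom m) = D (gen x) * monom m + qscale ((-1) ^ gdeg x) (gen x * D (monom m))"
    by (intro differential_times[OF D] xm gen_homogeneous)
  finally have eq: "restrict_to A (D (monom (add_mset x m))) =
      Poly_Mapping.single 0 k * (restrict_to A (D (gen x)) * restrict_to A (monom m)
      + Poly_Mapping.single 0 ((-1) ^ gdeg x) * (restrict_to A (gen x) * restrict_to A (D (monom m))))"
    by (simp add: restrict_to_qscale restrict_to_add restrict_to_times[OF A])
  have "restrict_to A (D (gen x)) * restrict_to A (monom m) \<in> P.span (?S (mdeg (add_mset x m)))"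
  proof (cases "x \<in> V \<and> set_mset m \<subseteq> A")
    case True
    then show ?thesis
      using m(1) by (intro P.span_base) (auto simp: restrict_to_monom mult.commute intro!: exI[of _ m] exI[of _ x])
  next
    case False
    then have "restrict_to A (D (gen x)) * restrict_to A (monom m) = 0"
      using x DA DU by (auto simp: restrict_to_monom restrict_to_zero)
    then show ?thesis by (simp only: P.span_zero)
  qed
  moreover have "restrict_to A (gen x) * restrict_to A (D (monom m)) \<in> P.span (?S (mdeg (add_mset x m)))"
  proof (cases "x \<in> A")
    case True
    have "Poly_Mapping.single {#x#} 1 * restrict_to A (D (monom m)) \<in> P.span (?S (mdeg (add_mset x m)))"
    proof (rule P.span_image_linear[OF add.IH[OF m]])
      fix p assume "p \<in> ?S (mdeg m)"
      then obtain b v where bv: "p = Poly_Mapping.single b 1 * restrict_to A (D (gen v))"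
          "set_mset b \<subseteq> A" "v \<in> V" "mdeg b + gdeg v = mdeg m"
        by blast
      then have "Poly_Mapping.single {#x#} 1 * p
          = Poly_Mapping.single (add_mset x b) 1 * restrict_to A (D (gen v))"
        by (simp add: mult_single flip: mult.assoc)
      then show "Poly_Mapping.single {#x#} 1 * p \<in> P.span (?S (mdeg (add_mset x m)))"
        using bv True by (intro P.span_base) (auto intro!: exI[of _ "add_mset x b"] exI[of _ v])
    qed (simp_all add: algebra_simps)
    then show ?thesis using True by (simp add: gen_eq_monom restrict_to_monom)
  qed (simp add: gen_eq_monom restrict_to_monom P.span_zero)
  ultimately show ?case unfolding eq by (intro P.span_scale P.span_add)
qed

text \<open>
  Finitely many classes involve monomials of bounded degree only, so a monomial in \<open>A\<close> of high degree,
  which is a cocycle, equals the part of a coboundary \<open>D x\<close> in its degree.  Its image in \<open>\<rat>[A]\<close> lies in the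
  ideal generated by the images of the \<open>D v\<close>, with cofactors of smaller size.
\<close>
lemma finite_cohomology_bounds_base:
  assumes D: "differential (A \<union> (U \<union> V)) D" and A: "finite A" "\<forall>a\<in>A. gdeg a = 2"
    and V: "finite V"
    and DA: "\<forall>a\<in>A. D (gen a) = 0" and DU: "\<forall>u\<in>U. D (gen u) = 0"
    and fin: "finite_dim_cohomology (A \<union> (U \<union> V)) D"
  shows "card A \<le> card V"
proof -
  let ?X = "A \<union> (U \<union> V)"
  have evenA: "\<forall>a\<in>A. even (gdeg a)" using A(2) by simp
  obtain B where B: "finite B" "B \<subseteq> cocycles ?X D"
    and rep: "\<And>z. z \<in> cocycles ?X D \<Longrightarrow> \<exists>y\<in>Q.span B. z - y \<in> coboundaries ?X D"
    using fin unfolding finite_dim_cohomology_def by blast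
  define N where "N = Max (insert 0 (mdeg ` (\<Union>b\<in>B. {m. coeff b m \<noteq> 0})))"
  have N: "mdeg m \<le> N" if "b \<in> B" "coeff b m \<noteq> 0" for b m
    unfolding N_def using that B(1) finite_coeff by (intro Max_ge) auto
  have spanB: "coeff y m = 0" if "y \<in> Q.span B" "mdeg m > N" for y m
  proof -
    have "Q.span B \<subseteq> {y. coeff y m = 0}"
      by (rule Q.span_minimal) (use N that(2) in \<open>fastforce simp: Q.subspace_def\<close>)+
    then show ?thesis using that(1) by auto
  qed
  show ?thesis
  proof (rule variables_le_generators[where N = N and f = "\<lambda>v. restrict_to A (D (gen v))"])
    fix m assume m: "set_mset m \<subseteq> A" "size m > N"
    have deg: "mdeg m = 2 * size m" using m(1) A(2) by (rule mdeg_degree_two)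
    have adm: "admissible m"
    proof -
      have "count m x = 0" if "odd (gdeg x)" for x
        using that evenA m(1) by (auto simp: count_eq_zero_iff)
      then show ?thesis by (simp add: admissible_def)
    qed
    have mX: "monom m \<in> \<Lambda> ?X" using m(1) by (intro monom_in_Lambda) auto
    have "D (monom m) = 0"
      using differential_eq_contractions[OF D, of A "{}" "monom m"] DA m(1)
      by (auto intro: monom_in_Lambda)
    then have "monom m \<in> cocycles ?X D" using mX by (simp add: cocycles_def)
    then obtain y x where y: "y \<in> Q.span B" and x: "x \<in> \<Lambda> ?X" and eq: "monom m - y = D x"
      using rep by (fastforce simp: coboundaries_def)
    have homog: "mdeg l = mdeg n + 1" if "coeff x n \<noteq> 0" "coeff (D (monom n)) l \<noteq> 0" for n l
    proof -
      have "monom n \<in> \<Lambda> ?X" using x that(1) by (intro monom_in_Lambda) (auto simp: mem_Lambda_iff)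
      then have "D (monom n) \<in> homogeneous (mdeg n + 1)"
        by (intro differential_homogeneous[OF D] monom_homogeneous)
      then show ?thesis using that(2) by (rule homogeneousD)
    qed
    let ?M = "{n. coeff x n \<noteq> 0 \<and> mdeg n + 1 = mdeg m}"
    have "Poly_Mapping.single m 1 = (\<Sum>n\<in>?M. Poly_Mapping.single 0 (coeff x n) * restrict_to A (D (monom n)))"
    proof (rule poly_mapping_eqI)
      fix l
      have "(\<Sum>n\<in>?M. coeff x n * coeff (D (monom n)) l) = coeff (monom m) l"
      proof (cases "mdeg l = mdeg m")
        case True
        have "coeff y l = 0" using spanB[OF y] True deg m(2) by simp
        then have "coeff (monom m) l = coeff (D x) l" using arg_cong[OF eq, of "\<lambda>p. coeff p l"] by simp
        also have "\<dots> = (\<Sum>n | coeff x n \<noteq> 0. coeff x n * coeff (D (monom n)) l)"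
          by (subst differential_eq_sum_monom[OF D x]) (simp add: coeff_sum)
        also have "\<dots> = (\<Sum>n\<in>?M. coeff x n * coeff (D (monom n)) l)"
          by (rule sum.mono_neutral_right) (use True finite_coeff in \<open>auto dest: homog\<close>)
        finally show ?thesis by simp
      next
        case False
        then have "(\<Sum>n\<in>?M. coeff x n * coeff (D (monom n)) l) = 0"
          by (intro sum.neutral) (auto dest: homog)
        then show ?thesis using False by (auto simp: coeff_monom)
      qed
      then show "Poly_Mapping.lookup (Poly_Mapping.single m 1) l = Poly_Mapping.lookup
          (\<Sum>n\<in>?M. Poly_Mapping.single 0 (coeff x n) * restrict_to A (D (monom n))) l"
        using adm m(1)
        by (cases "set_mset l \<subseteq> A")
          (auto simp: lookup_sum lookup_restrict_to coeff_monom lookup_single when_def)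
    qed
    also have "\<dots> \<in> P.span {Poly_Mapping.single b 1 * restrict_to A (D (gen v)) | b v.
        set_mset b \<subseteq> A \<and> size b < size m \<and> v \<in> V}"
    proof (intro P.span_sum P.span_scale)
      fix n assume n: "n \<in> ?M"
      have "restrict_to A (D (monom n)) \<in> P.span {Poly_Mapping.single b 1 * restrict_to A (D (gen v)) | b v.
          set_mset b \<subseteq> A \<and> v \<in> V \<and> mdeg b + gdeg v = mdeg n}"
        using n x by (intro base_part_of_boundary[OF D evenA DA DU])
          (auto simp: mem_Lambda_iff coeff_admissible)
      also have "\<dots> \<subseteq> P.span {Poly_Mapping.single b 1 * restrict_to A (D (gen v)) | b v.
          set_mset b \<subseteq> A \<and> size b < size m \<and> v \<in> V}"
      proof (rule P.span_mono, clarify)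
        fix b v assume "set_mset b \<subseteq> A" "v \<in> V" "mdeg b + gdeg v = mdeg n"
        moreover from this(1) have "mdeg b = 2 * size b" using A(2) by (rule mdeg_degree_two)
        ultimately show "\<exists>b' v'. Poly_Mapping.single b 1 * restrict_to A (D (gen v)) =
            Poly_Mapping.single b' 1 * restrict_to A (D (gen v')) \<and>
            set_mset b' \<subseteq> A \<and> size b' < size m \<and> v' \<in> V"
          using n deg by (intro exI[of _ b] exI[of _ v]) auto
      qed
      finally show "restrict_to A (D (monom n)) \<in> P.span {Poly_Mapping.single b 1 * restrict_to A (D (gen v)) | b v.
        set_mset b \<subseteq> A \<and> size b < size m \<and> v \<in> V}" .
    qed
    finally show "Poly_Mapping.single m 1 \<in> P.span {Poly_Mapping.single b 1 * restrict_to A (D (gen v)) | b v.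
        set_mset b \<subseteq> A \<and> size b < size m \<and> v \<in> V}" .
  qed (use A V in auto)
qed

section \<open>The toral rank bound\<close>

lemma connected_grD: "connected_gr n Z \<Longrightarrow> z \<in> Z \<Longrightarrow> n < gdeg z"
  by (rule ccontr) (auto simp: connected_gr_def not_less)

lemma coconnected_grD: "coconnected_gr n Z \<Longrightarrow> z \<in> Z \<Longrightarrow> gdeg z < n"
  by (rule ccontr) (auto simp: coconnected_gr_def not_less)

theorem theorem2p10:
  fixes U V :: "gen set" and d :: "gca \<Rightarrow> gca" and r s t u :: nat
  assumes "two_stage U V d"
    and "elliptic (U \<union> V) d"
    and "\<forall>x\<in>U \<union> V. odd (gdeg x)"
    and "displays_max_dim U V d"
    and "r > 0" and "s > 0" and "r \<le> s" and "s \<le> 2 * r"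
    and "connected_gr (r - 1) U" and "coconnected_gr (s + 1) U"
    and "t > 0" and "u > 0" and "s \<le> t" and "t \<le> u" and "u \<le> s + r"
    and "connected_gr (t - 1) V" and "coconnected_gr (u + 1) V"
  shows "rk0 (U \<union> V) d \<le> enat (card V)"
  unfolding rk0_def
proof (rule Sup_least, clarify)
  fix n assume "toral_ext (U \<union> V) d n"
  then obtain A D where A: "finite A" "card A = n" "\<forall>a\<in>A. gdeg a = 2"
    and ext: "ks_extension A (U \<union> V) d D" and cohom: "finite_dim_cohomology (A \<union> (U \<union> V)) D"
    by (auto simp: toral_ext_def)
  have D: "differential (A \<union> (U \<union> V)) D" and DA: "\<forall>a\<in>A. D (gen a) = 0"
    using ext by (auto simp: ks_extension_def)
  have fin: "finite U" "finite V" using assms(2) by (auto simp: elliptic_def)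
  have degU: "r \<le> gdeg x \<and> gdeg x \<le> s" if "x \<in> U" for x
    using connected_grD[OF assms(9) that] coconnected_grD[OF assms(10) that] by simp
  have degV: "t \<le> gdeg x \<and> gdeg x \<le> u" if "x \<in> V" for x
    using connected_grD[OF assms(16) that] coconnected_grD[OF assms(17) that] by simp
  have degW: "r \<le> gdeg x" if "x \<in> U \<union> V" for x
    using that degU degV assms(7,13) by fastforce
  have homog: "even (mdeg m)" "mdeg m = gdeg x + 1" "set_mset m \<subseteq> A \<union> (U \<union> V)"
    if "x \<in> U \<union> V" "coeff (D (gen x)) m \<noteq> 0" for x m
  proof -
    have gx: "gen x \<in> \<Lambda> (A \<union> (U \<union> V))" using that(1) by (intro gen_in_Lambda) auto
    show deg: "mdeg m = gdeg x + 1"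
      using differential_homogeneous[OF D gx gen_homogeneous] that(2) by (rule homogeneousD)
    show "even (mdeg m)" using assms(3) that(1) unfolding deg by simp
    show "set_mset m \<subseteq> A \<union> (U \<union> V)"
      using differential_in_Lambda[OF D gx] that(2) by (simp add: mem_Lambda_iff)
  qed
  have DU: "\<forall>x\<in>U. D (gen x) \<in> \<Lambda> A"
    unfolding mem_Lambda_iff
  proof (intro ballI allI impI subsetI, rule ccontr)
    fix x m w assume x: "x \<in> U" and m: "coeff (D (gen x)) m \<noteq> 0" and w: "w \<in># m" "w \<notin> A"
    have "d (gen x) = 0" using assms(1) x by (simp add: two_stage_def gen_in_lin)
    then obtain a where a: "a \<in> A" "a \<in># m"
      using extension_coeff[OF ext, of "gen x" m] m x by (auto intro: gen_in_Lambda)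
    have wW: "w \<in> U \<union> V" using homog(3)[of x m] x m w by auto
    obtain w' where "w' \<in> U \<union> V" "gdeg w + gdeg w' + 2 \<le> mdeg m"
      using mixed_monomial_degree[OF homog(1,3)[of x m] A(3) a w(1)] x m wW assms(3) by auto
    then show False
      using homog(2)[of x m] x m degU[OF x] degW[OF wW] degW[of w'] assms(8) by auto
  qed
  have DV: "\<forall>v\<in>V. D (gen v) \<in> \<Lambda> (A \<union> U)"
    unfolding mem_Lambda_iff
  proof (intro ballI allI impI subsetI, rule ccontr)
    fix x m w assume x: "x \<in> V" and m: "coeff (D (gen x)) m \<noteq> 0" and w: "w \<in># m" "w \<notin> A \<union> U"
    have wV: "w \<in> V" using homog(3)[of x m] x m w by auto
    have "d (gen x) \<in> \<Lambda> U" using assms(1) x by (simp add: two_stage_def gen_in_lin)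
    then have "coeff (d (gen x)) m = 0" using w by (auto simp: mem_Lambda_iff)
    then obtain a where a: "a \<in> A" "a \<in># m"
      using extension_coeff[OF ext, of "gen x" m] m x by (auto intro: gen_in_Lambda)
    obtain w' where "w' \<in> U \<union> V" "gdeg w + gdeg w' + 2 \<le> mdeg m"
      using mixed_monomial_degree[OF homog(1,3)[of x m] A(3) a w(1)] x m wV assms(3) by auto
    then show False
      using homog(2)[of x m] x m degV[OF x] degV[OF wV] degW[of w'] assms(13,15) by auto
  qed
  have "card A \<le> card V"
    using base_differential_vanishes[OF assms(1,4) fin assms(3) ext A(3) DU DV]
    by (intro finite_cohomology_bounds_base[OF D A(1,3) fin(2) DA _ cohom])
  then show "enat n \<le> enat (card V)" using A(2) by simp
qed

end
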